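(* Let $n\ge 2$ and $m\ge 1$ be integers, and let $F_n(m)$ be the free $\Delta$-Łukasiewicz residuation algebra of order $n$ on $m$ free generators. Then $$|F_n(m)| = \sum_{k=1}^{m} (-1)^{k+1}\binom{m}{k}\prod_{i=2}^{n} i^{\beta_i(k)},$$ where, for $1\le k\le m$, the numbers $\beta_i(k)$ ($2\le i\le n$) are determined recursively by $$\beta_i(k) = (i-1)^k\, i^{m-k} - \sum_{\substack{2\le j<i\\ (j-1)\mid (i-1)}} \beta_j(k).$$
   Context: A Łukasiewicz residuation algebra is an algebra $\langle A,\rightarrowtail,1\rangle$ of type $(2,0)$ satisfying the identities $x\rightarrowtail(y\rightarrowtail x)=1$; $(x\rightarrowtail y)\rightarrowtail((y\rightarrowtail z)\rightarrowtail(x\rightarrowtail z))=1$; $(x\rightarrowtail y)\rightarrowtail y=(y\rightarrowtail x)\rightarrowtail x$; $((x\rightarrowtail y)\rightarrowtail(y\rightarrowtail x))\rightarrowtail(y\rightarrowtail x)=1$; $1\rightarrowtail x=x$. Put $x\vee y:=(x\rightarrowtail y)\rightarrowtail y$, $x\to_0 y:=y$ and $x\to_{k+1}y:=x\rightarrowtail(x\to_k y)$ for $k\ge 0$. For $n\ge 2$, the algebra is $n$-valued if it satisfies $(x\to_{n-1}y)\vee x=1$. A $\Delta$-Łukasiewicz residuation algebra of order $n$ ($n\ge2$) is an algebra $\langle A,\rightarrowtail,\Delta,1\rangle$ of type $(2,1,0)$ such that $\langle A,\rightarrowtail,1\rangle$ is an $n$-valued Łukasiewicz residuation algebra and the identities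 $\Delta x\rightarrowtail y=x\to_{n-1}y$ and $\Delta(\Delta x\rightarrowtail y)=\Delta x\rightarrowtail\Delta y$ hold. These algebras form a variety, and "free" means free in this variety. *)

theory Defs
  imports Complex_Main
begin

section \<open>Lukasiewicz residuation algebras\<close>

record 'a dl_algebra =
  dl_carrier :: "'a set"
  dl_imp :: "'a \<Rightarrow> 'a \<Rightarrow> 'a"
  dl_delta :: "'a \<Rightarrow> 'a"
  dl_one :: 'a

definition join :: "('a \<Rightarrow> 'a \<Rightarrow> 'a) \<Rightarrow> 'a \<Rightarrow> 'a \<Rightarrow> 'a" where
  "join imp x y = imp (imp x y) y"

definition iter_imp :: "('a \<Rightarrow> 'a \<Rightarrow> 'a) \<Rightarrow> nat \<Rightarrow> 'a \<Rightarrow> 'a \<Rightarrow> 'a" where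
  "iter_imp imp k x y = ((imp x) ^^ k) y"

locale lukasiewicz_residuation_algebra =
  fixes A :: "'a set" and imp :: "'a \<Rightarrow> 'a \<Rightarrow> 'a" and one :: 'a
  assumes imp_closed: "x \<in> A \<Longrightarrow> y \<in> A \<Longrightarrow> imp x y \<in> A"
    and one_closed: "one \<in> A"
    and weakening: "x \<in> A \<Longrightarrow> y \<in> A \<Longrightarrow> imp x (imp y x) = one"
    and transitivity: "x \<in> A \<Longrightarrow> y \<in> A \<Longrightarrow> z \<in> A \<Longrightarrow>
      imp (imp x y) (imp (imp y z) (imp x z)) = one"
    and commutation: "x \<in> A \<Longrightarrow> y \<in> A \<Longrightarrow> imp (imp x y) y = imp (imp y x) x"
    and prelinearity: "x \<in> A \<Longrightarrow> y \<in> A \<Longrightarrow>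
      imp (imp (imp x y) (imp y x)) (imp y x) = one"
    and one_imp: "x \<in> A \<Longrightarrow> imp one x = x"

locale n_valued_lukasiewicz_residuation_algebra = lukasiewicz_residuation_algebra +
  fixes n :: nat
  assumes n_valued: "x \<in> A \<Longrightarrow> y \<in> A \<Longrightarrow> join imp (iter_imp imp (n - 1) x y) x = one"

locale delta_lukasiewicz_residuation_algebra =
  n_valued_lukasiewicz_residuation_algebra "dl_carrier B" "dl_imp B" "dl_one B" n
  for B :: "('a, 'r) dl_algebra_scheme" and n :: nat +
  assumes order_ge_2: "n \<ge> 2"
    and delta_closed: "x \<in> dl_carrier B \<Longrightarrow> dl_delta B x \<in> dl_carrier B"
    and delta_imp: "x \<in> dl_carrier B \<Longrightarrow> y \<in> dl_carrier B \<Longrightarrow>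
      dl_imp B (dl_delta B x) y = iter_imp (dl_imp B) (n - 1) x y"
    and delta_delta_imp: "x \<in> dl_carrier B \<Longrightarrow> y \<in> dl_carrier B \<Longrightarrow>
      dl_delta B (dl_imp B (dl_delta B x) y) = dl_imp B (dl_delta B x) (dl_delta B y)"

definition dl_hom ::
  "('a, 'r) dl_algebra_scheme \<Rightarrow> ('b, 's) dl_algebra_scheme \<Rightarrow> ('a \<Rightarrow> 'b) \<Rightarrow> bool" where
  "dl_hom A B h \<longleftrightarrow>
     (\<forall>x\<in>dl_carrier A. h x \<in> dl_carrier B) \<and>
     (\<forall>x\<in>dl_carrier A. \<forall>y\<in>dl_carrier A. h (dl_imp A x y) = dl_imp B (h x) (h y)) \<and>
     (\<forall>x\<in>dl_carrier A. h (dl_delta A x) = dl_delta B (h x)) \<and>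
     h (dl_one A) = dl_one B"


section \<open>The free algebra\<close>

text \<open>
  The free algebra over \<open>X\<close> is the algebra of terms over \<open>X\<close> modulo the least congruence
  containing all instances of the defining identities of the variety.  That it is free on \<open>X\<close>
  is shown in \<open>free_dl_algebra_in_variety\<close>, \<open>free_dl_algebra_universal\<close> and
  \<open>inj_on_free_gen\<close> below.
\<close>

datatype (dl_vars: 'x) dl_term =
    Gen 'x
  | Imp "'x dl_term" "'x dl_term"
  | Delta "'x dl_term"
  | One

definition dl_terms :: "'x set \<Rightarrow> 'x dl_term set" where
  "dl_terms X = {t. dl_vars t \<subseteq> X}"

inductive dl_eq :: "nat \<Rightarrow> 'x set \<Rightarrow> 'x dl_term \<Rightarrow> 'x dl_term \<Rightarrow> bool"
  for n :: nat and X :: "'x set" where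
  refl: "s \<in> dl_terms X \<Longrightarrow> dl_eq n X s s"
| sym: "dl_eq n X s t \<Longrightarrow> dl_eq n X t s"
| trans: "dl_eq n X s t \<Longrightarrow> dl_eq n X t u \<Longrightarrow> dl_eq n X s u"
| cong_Imp: "dl_eq n X s s' \<Longrightarrow> dl_eq n X t t' \<Longrightarrow> dl_eq n X (Imp s t) (Imp s' t')"
| cong_Delta: "dl_eq n X s s' \<Longrightarrow> dl_eq n X (Delta s) (Delta s')"
| weakening: "s \<in> dl_terms X \<Longrightarrow> t \<in> dl_terms X \<Longrightarrow> dl_eq n X (Imp s (Imp t s)) One"
| transitivity: "s \<in> dl_terms X \<Longrightarrow> t \<in> dl_terms X \<Longrightarrow> u \<in> dl_terms X \<Longrightarrow>
    dl_eq n X (Imp (Imp s t) (Imp (Imp t u) (Imp s u))) One"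
| commutation: "s \<in> dl_terms X \<Longrightarrow> t \<in> dl_terms X \<Longrightarrow>
    dl_eq n X (Imp (Imp s t) t) (Imp (Imp t s) s)"
| prelinearity: "s \<in> dl_terms X \<Longrightarrow> t \<in> dl_terms X \<Longrightarrow>
    dl_eq n X (Imp (Imp (Imp s t) (Imp t s)) (Imp t s)) One"
| one_imp: "s \<in> dl_terms X \<Longrightarrow> dl_eq n X (Imp One s) s"
| n_valued: "s \<in> dl_terms X \<Longrightarrow> t \<in> dl_terms X \<Longrightarrow>
    dl_eq n X (join Imp (iter_imp Imp (n - 1) s t) s) One"
| delta_imp: "s \<in> dl_terms X \<Longrightarrow> t \<in> dl_terms X \<Longrightarrow>
    dl_eq n X (Imp (Delta s) t) (iter_imp Imp (n - 1) s t)"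
| delta_delta_imp: "s \<in> dl_terms X \<Longrightarrow> t \<in> dl_terms X \<Longrightarrow>
    dl_eq n X (Delta (Imp (Delta s) t)) (Imp (Delta s) (Delta t))"

definition dl_class :: "nat \<Rightarrow> 'x set \<Rightarrow> 'x dl_term \<Rightarrow> 'x dl_term set" where
  "dl_class n X t = {s. dl_eq n X t s}"

definition free_dl_algebra :: "nat \<Rightarrow> 'x set \<Rightarrow> 'x dl_term set dl_algebra" where
  "free_dl_algebra n X =
    \<lparr> dl_carrier = dl_class n X ` dl_terms X,
      dl_imp = (\<lambda>P Q. \<Union>s\<in>P. \<Union>t\<in>Q. dl_class n X (Imp s t)),
      dl_delta = (\<lambda>P. \<Union>s\<in>P. dl_class n X (Delta s)),
      dl_one = dl_class n X One \<rparr>"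

definition free_gen :: "nat \<Rightarrow> 'x set \<Rightarrow> 'x \<Rightarrow> 'x dl_term set" where
  "free_gen n X x = dl_class n X (Gen x)"

lemma dl_terms_simps [simp]:
  "Gen x \<in> dl_terms X \<longleftrightarrow> x \<in> X"
  "Imp s t \<in> dl_terms X \<longleftrightarrow> s \<in> dl_terms X \<and> t \<in> dl_terms X"
  "Delta s \<in> dl_terms X \<longleftrightarrow> s \<in> dl_terms X"
  "One \<in> dl_terms X"
  by (auto simp: dl_terms_def)

lemma iter_imp_simps [simp]:
  "iter_imp imp 0 x y = y"
  "iter_imp imp (Suc k) x y = imp x (iter_imp imp k x y)"
  by (simp_all add: iter_imp_def)

lemma iter_imp_terms [simp]:
  "s \<in> dl_terms X \<Longrightarrow> t \<in> dl_terms X \<Longrightarrow> iter_imp Imp k s t \<in> dl_terms X"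
  by (induction k) auto

lemma dl_eq_terms: "dl_eq n X s t \<Longrightarrow> s \<in> dl_terms X \<and> t \<in> dl_terms X"
  by (induction rule: dl_eq.induct) (auto simp: join_def)

lemma dl_class_eq_iff:
  assumes "s \<in> dl_terms X" "t \<in> dl_terms X"
  shows "dl_class n X s = dl_class n X t \<longleftrightarrow> dl_eq n X s t"
proof
  assume "dl_class n X s = dl_class n X t"
  moreover have "t \<in> dl_class n X t"
    using assms by (simp add: dl_class_def dl_eq.refl)
  ultimately show "dl_eq n X s t"
    by (simp add: dl_class_def set_eq_iff)
next
  assume "dl_eq n X s t"
  then show "dl_class n X s = dl_class n X t"
    unfolding dl_class_def by (blast intro: dl_eq.sym dl_eq.trans)
qed

lemma dl_class_eqI: "dl_eq n X s t \<Longrightarrow> dl_class n X s = dl_class n X t"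
  using dl_class_eq_iff dl_eq_terms by metis

lemma free_carrier: "dl_carrier (free_dl_algebra n X) = dl_class n X ` dl_terms X"
  by (simp add: free_dl_algebra_def)

lemma free_one: "dl_one (free_dl_algebra n X) = dl_class n X One"
  by (simp add: free_dl_algebra_def)

lemma free_imp:
  assumes "s \<in> dl_terms X" "t \<in> dl_terms X"
  shows "dl_imp (free_dl_algebra n X) (dl_class n X s) (dl_class n X t) = dl_class n X (Imp s t)"
proof -
  have "dl_class n X (Imp s' t') = dl_class n X (Imp s t)"
    if "s' \<in> dl_class n X s" "t' \<in> dl_class n X t" for s' t'
    using that by (intro dl_class_eqI) (auto simp: dl_class_def intro: dl_eq.cong_Imp dl_eq.sym)
  moreover have "s \<in> dl_class n X s" "t \<in> dl_class n X t"
    using assms by (auto simp: dl_class_def dl_eq.refl)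
  ultimately have "(\<Union>s'\<in>dl_class n X s. \<Union>t'\<in>dl_class n X t. dl_class n X (Imp s' t')) =
      dl_class n X (Imp s t)"
    by blast
  then show ?thesis
    by (simp add: free_dl_algebra_def)
qed

lemma free_delta:
  assumes "s \<in> dl_terms X"
  shows "dl_delta (free_dl_algebra n X) (dl_class n X s) = dl_class n X (Delta s)"
proof -
  have "dl_class n X (Delta s') = dl_class n X (Delta s)" if "s' \<in> dl_class n X s" for s'
    using that by (intro dl_class_eqI) (auto simp: dl_class_def intro: dl_eq.cong_Delta dl_eq.sym)
  moreover have "s \<in> dl_class n X s"
    using assms by (auto simp: dl_class_def dl_eq.refl)
  ultimately have "(\<Union>s'\<in>dl_class n X s. dl_class n X (Delta s')) = dl_class n X (Delta s)"
    by blast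
  then show ?thesis
    by (simp add: free_dl_algebra_def)
qed

lemma free_iter_imp:
  assumes "s \<in> dl_terms X" "t \<in> dl_terms X"
  shows "iter_imp (dl_imp (free_dl_algebra n X)) k (dl_class n X s) (dl_class n X t) =
    dl_class n X (iter_imp Imp k s t)"
  using assms by (induction k) (simp_all add: free_imp)

theorem free_dl_algebra_in_variety:
  assumes "n \<ge> 2"
  shows "delta_lukasiewicz_residuation_algebra (free_dl_algebra n X) n"
  using assms
  by unfold_locales
    (auto simp: free_carrier free_one free_imp free_delta free_iter_imp join_def
        dl_class_eq_iff
      simp del: One_nat_def
      intro!: dl_eq.weakening dl_eq.transitivity dl_eq.commutation
        dl_eq.prelinearity dl_eq.one_imp dl_eq.n_valued[unfolded join_def] dl_eq.delta_imp
        dl_eq.delta_delta_imp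
      del: equalityI)

primrec dl_eval :: "('b, 's) dl_algebra_scheme \<Rightarrow> ('x \<Rightarrow> 'b) \<Rightarrow> 'x dl_term \<Rightarrow> 'b" where
  "dl_eval B f (Gen x) = f x"
| "dl_eval B f (Imp s t) = dl_imp B (dl_eval B f s) (dl_eval B f t)"
| "dl_eval B f (Delta s) = dl_delta B (dl_eval B f s)"
| "dl_eval B f One = dl_one B"

lemma dl_eval_iter_imp:
  "dl_eval B f (iter_imp Imp k s t) = iter_imp (dl_imp B) k (dl_eval B f s) (dl_eval B f t)"
  by (induction k) simp_all

lemma dl_eval_sound:
  assumes "delta_lukasiewicz_residuation_algebra B n" and "\<forall>x\<in>X. f x \<in> dl_carrier B"
  shows "t \<in> dl_terms X \<Longrightarrow> dl_eval B f t \<in> dl_carrier B"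
    and "dl_eq n X s t \<Longrightarrow> dl_eval B f s = dl_eval B f t"
proof -
  interpret delta_lukasiewicz_residuation_algebra B n by fact
  show closed: "t \<in> dl_terms X \<Longrightarrow> dl_eval B f t \<in> dl_carrier B" for t
    by (induction t) (use assms(2) in \<open>auto intro: imp_closed delta_closed one_closed\<close>)
  show "dl_eq n X s t \<Longrightarrow> dl_eval B f s = dl_eval B f t"
  proof (induction rule: dl_eq.induct)
    case (n_valued s t)
    then show ?case
      using n_valued_lukasiewicz_residuation_algebra.n_valued[OF
          n_valued_lukasiewicz_residuation_algebra_axioms, of "dl_eval B f s" "dl_eval B f t"]
      by (simp add: join_def dl_eval_iter_imp closed)
  next
    case (delta_delta_imp s t)
    then show ?case
      using delta_lukasiewicz_residuation_algebra.delta_delta_imp[OF assms(1),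
          of "dl_eval B f s" "dl_eval B f t"]
      by (simp only: dl_eval.simps closed)
  qed (simp_all add: closed dl_eval_iter_imp weakening transitivity prelinearity one_imp
        delta_imp commutation)
qed

theorem free_dl_algebra_universal:
  assumes "delta_lukasiewicz_residuation_algebra B n" and "\<forall>x\<in>X. f x \<in> dl_carrier B"
  shows "\<exists>h. dl_hom (free_dl_algebra n X) B h \<and> (\<forall>x\<in>X. h (free_gen n X x) = f x)"
    and "dl_hom (free_dl_algebra n X) B h \<Longrightarrow> dl_hom (free_dl_algebra n X) B h' \<Longrightarrow>
      \<forall>x\<in>X. h (free_gen n X x) = h' (free_gen n X x) \<Longrightarrow>
      c \<in> dl_carrier (free_dl_algebra n X) \<Longrightarrow> h c = h' c"
proof -
  define h where "h c = dl_eval B f (SOME t. t \<in> c)" for c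
  have h: "h (dl_class n X t) = dl_eval B f t" if "t \<in> dl_terms X" for t
  proof -
    have "t \<in> dl_class n X t"
      using that by (simp add: dl_class_def dl_eq.refl)
    then have "(SOME s. s \<in> dl_class n X t) \<in> dl_class n X t"
      by (rule someI)
    then show ?thesis
      using dl_eval_sound(2)[OF assms] by (simp add: h_def dl_class_def)
  qed
  have "dl_hom (free_dl_algebra n X) B h"
    using dl_eval_sound(1)[OF assms]
    by (auto simp: dl_hom_def free_carrier free_one free_imp free_delta h)
  moreover have "\<forall>x\<in>X. h (free_gen n X x) = f x"
    by (simp add: free_gen_def h)
  ultimately show "\<exists>h. dl_hom (free_dl_algebra n X) B h \<and> (\<forall>x\<in>X. h (free_gen n X x) = f x)"
    by blast
next
  assume hom: "dl_hom (free_dl_algebra n X) B h" "dl_hom (free_dl_algebra n X) B h'"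
    and gen: "\<forall>x\<in>X. h (free_gen n X x) = h' (free_gen n X x)"
    and c: "c \<in> dl_carrier (free_dl_algebra n X)"
  have hom_rules:
    "k (dl_class n X One) = dl_one B"
    "\<And>s t. s \<in> dl_terms X \<Longrightarrow> t \<in> dl_terms X \<Longrightarrow>
      k (dl_class n X (Imp s t)) = dl_imp B (k (dl_class n X s)) (k (dl_class n X t))"
    "\<And>s. s \<in> dl_terms X \<Longrightarrow> k (dl_class n X (Delta s)) = dl_delta B (k (dl_class n X s))"
    if "dl_hom (free_dl_algebra n X) B k" for k
    using that by (auto simp: dl_hom_def free_carrier free_one simp flip: free_imp free_delta)
  have "t \<in> dl_terms X \<Longrightarrow> h (dl_class n X t) = h' (dl_class n X t)" for t
    by (induction t) (use gen in \<open>auto simp: hom_rules[OF hom(1)] hom_rules[OF hom(2)] free_gen_def\<close>)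
  then show "h c = h' c"
    using c by (auto simp: free_carrier)
qed

theorem inj_on_free_gen:
  assumes "n \<ge> 2"
  shows "inj_on (free_gen n X) X"
proof
  define B :: "bool dl_algebra" where
    "B = \<lparr>dl_carrier = UNIV, dl_imp = (\<longrightarrow>), dl_delta = id, dl_one = True\<rparr>"
  have iter: "iter_imp (\<longrightarrow>) k x y \<longleftrightarrow> (if k = 0 then y else x \<longrightarrow> y)" for k x y
    by (cases x; cases y; induction k) auto
  have B: "delta_lukasiewicz_residuation_algebra B n"
    using assms by unfold_locales (auto simp: B_def join_def iter)
  fix x y assume xy: "x \<in> X" "y \<in> X" "free_gen n X x = free_gen n X y"
  obtain h where "\<forall>z\<in>X. h (free_gen n X z) = (z = x)"
    using free_dl_algebra_universal(1)[OF B, of X "\<lambda>z. z = x"] by (auto simp: B_def)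
  then show "x = y"
    using xy by metis
qed


section \<open>The exponents\<close>

text \<open>
  The values are integers, so that the subtraction is not truncated; the exponents
  \<open>\<beta>\<^sub>i(k)\<close> are those for \<open>i \<ge> 2\<close> and depend on \<open>m\<close> as well.
\<close>

function dl_beta :: "nat \<Rightarrow> nat \<Rightarrow> nat \<Rightarrow> int" where
  "dl_beta m k i = (int i - 1) ^ k * int i ^ (m - k) -
     (\<Sum>j | 2 \<le> j \<and> j < i \<and> (j - 1) dvd (i - 1). dl_beta m k j)"
  by pat_completeness auto
termination
  by (relation "measure (\<lambda>(m, k, i). i)") auto

declare dl_beta.simps [simp del]

end

theory Submission
  imports Defs "HOL-Library.FuncSet"
begin

text \<open>
  Why the formula holds.  Write the chain \<open>{0, 1/N, \<dots>, 1}\<close> with \<open>N + 1\<close> elements additively,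
  coding a truth value by its distance from \<open>1\<close> in steps of \<open>1/N\<close>: then \<open>1\<close> becomes \<open>0\<close>,
  \<open>x \<rightarrowtail> y\<close> becomes the truncated difference \<open>y - x\<close>, and \<open>\<Delta>\<close> sends everything but \<open>0\<close> to \<open>N\<close>.

  Every algebra of the variety is a subdirect product of such chains with \<open>1 \<le> N \<le> n - 1\<close>
  (\<open>separating_chain_hom\<close>).  Indeed a deductive system maximal among those missing a given
  \<open>a \<noteq> 1\<close> is prime (\<open>prime_deductive_exists\<close>), so the quotient is a chain; \<open>n\<close>-valuedness bounds
  the number of steps down to any element, which yields a coatom, and counting multiples of the
  coatom identifies the chain (\<open>chain_rank\<close>).  Consequently two terms are equal in the free
  algebra iff they take the same value at every valuation of the generators in a chain, and after
  dividing by the greatest common divisor of \<open>N\<close> and the values it suffices to look at primitive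
  valuations, those for which this divisor is \<open>1\<close> (\<open>dl_eq_iff_term_function\<close>).

  It remains to say which families of values come from terms.  The rightmost variable \<open>x\<close> of a
  term \<open>t\<close> satisfies \<open>\<Delta>x \<le> t\<close>, so the value of \<open>t\<close> vanishes wherever that of \<open>x\<close> does.
  Conversely, where \<open>x\<close> does not vanish, \<open>\<Delta>x\<close> is a bottom element and supplies negation;
  primitive valuations generate their whole chain (\<open>eval_onto\<close>) and are separated by terms
  (\<open>eval_separates\<close>), so an interpolation argument realises every family with that support.
  Thus the free algebra is the union over the generators \<open>x\<close> of full products of chains
  (\<open>term_function_image\<close>).  The intersection of the pieces belonging to a set \<open>S\<close> of \<open>k\<close>
  generators is the product over the primitive valuations without zeros on \<open>S\<close>; sorting all
  \<open>N\<^sup>k (N + 1)\<^sup>m\<^sup>-\<^sup>k\<close> valuations without zeros on \<open>S\<close> by their divisor gives the recursion for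
  \<open>\<beta>\<^sub>N\<^sub>+\<^sub>1(k)\<close> (\<open>dl_beta_eq_card\<close>), and inclusion-exclusion gives the cardinality.
\<close>


section \<open>Implication in Lukasiewicz residuation algebras\<close>

context lukasiewicz_residuation_algebra
begin

text \<open>
  The order is \<open>x \<le> y\<close> iff \<open>imp x y = one\<close>.  Membership in the carrier is a side condition of
  nearly every fact, hence the closure rules in the simpset.
\<close>

declare imp_closed [simp] one_closed [simp] one_imp [simp]

lemma iter_imp_closed [simp]: "x \<in> A \<Longrightarrow> y \<in> A \<Longrightarrow> iter_imp imp k x y \<in> A"
  by (induction k) simp_all

lemma imp_one [simp]: "x \<in> A \<Longrightarrow> imp x one = one"
  using weakening[of one x] by simp

lemma imp_refl [simp]: "x \<in> A \<Longrightarrow> imp x x = one"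
  using commutation[of x one] by simp

lemma imp_antisym:
  assumes "x \<in> A" "y \<in> A" "imp x y = one" "imp y x = one"
  shows "x = y"
  using commutation[of x y] assms by simp

lemma imp_trans:
  assumes "x \<in> A" "y \<in> A" "z \<in> A" "imp x y = one" "imp y z = one"
  shows "imp x z = one"
  using transitivity[of x y z] assms by simp

lemma imp_antimono:
  assumes "x \<in> A" "y \<in> A" "z \<in> A" "imp x y = one"
  shows "imp (imp y z) (imp x z) = one"
  using transitivity[of x y z] assms by simp

lemma imp_mono:
  assumes "x \<in> A" "y \<in> A" "z \<in> A" "imp y z = one"
  shows "imp (imp x y) (imp x z) = one"
  using transitivity[of x y z] assms by simp

lemma le_join: "x \<in> A \<Longrightarrow> y \<in> A \<Longrightarrow> imp x (imp (imp x y) y) = one"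
  using commutation[of x y] weakening[of x "imp y x"] by simp

lemma join_absorb: "x \<in> A \<Longrightarrow> y \<in> A \<Longrightarrow> imp y x = one \<Longrightarrow> imp (imp x y) y = x"
  using commutation[of x y] by simp

lemma exchange_le:
  assumes "x \<in> A" "y \<in> A" "z \<in> A"
  shows "imp (imp x (imp y z)) (imp y (imp x z)) = one"
proof (rule imp_trans)
  show "imp (imp x (imp y z)) (imp (imp (imp y z) z) (imp x z)) = one"
    using assms by (simp add: transitivity)
  show "imp (imp (imp (imp y z) z) (imp x z)) (imp y (imp x z)) = one"
    using assms by (simp add: imp_antimono le_join)
qed (use assms in simp_all)

lemma exchange:
  assumes "x \<in> A" "y \<in> A" "z \<in> A"
  shows "imp x (imp y z) = imp y (imp x z)"
  using assms by (simp add: imp_antisym exchange_le)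

text \<open>
  If \<open>y \<le> z\<close> then \<open>z\<close> itself has the form \<open>(z \<rightarrowtail> y) \<rightarrowtail> y\<close>, and \<open>w \<mapsto> (w \<rightarrowtail> y) \<rightarrowtail> y\<close> is monotone.
\<close>
lemma join_least:
  assumes "x \<in> A" "y \<in> A" "z \<in> A" "imp x z = one" "imp y z = one"
  shows "imp (imp (imp x y) y) z = one"
proof -
  have "imp (imp (imp x y) y) (imp (imp z y) y) = one"
    using assms by (simp add: imp_antimono)
  then show ?thesis
    using assms by (simp add: join_absorb)
qed

lemma iter_imp_exchange:
  assumes "x \<in> A" "y \<in> A" "z \<in> A"
  shows "imp x (iter_imp imp k y z) = iter_imp imp k y (imp x z)"
  using assms by (induction k) (simp_all add: exchange[of x])

lemma iter_imp_add: "iter_imp imp (j + k) x y = iter_imp imp j x (iter_imp imp k x y)"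
  by (simp add: iter_imp_def funpow_add)

lemma iter_imp_add_one:
  assumes "x \<in> A" "y \<in> A" "iter_imp imp k x y = one"
  shows "iter_imp imp (j + k) x y = one"
  using assms by (induction j) simp_all

lemma iter_imp_mono:
  assumes "x \<in> A" "y \<in> A" "z \<in> A" "imp y z = one"
  shows "imp (iter_imp imp k x y) (iter_imp imp k x z) = one"
  using assms by (induction k) (simp_all add: imp_mono)

lemma iter_imp_antimono:
  assumes "x \<in> A" "y \<in> A" "z \<in> A" "imp x y = one"
  shows "imp (iter_imp imp k y z) (iter_imp imp k x z) = one"
proof (induction k)
  case (Suc k)
  have 1: "imp (imp y (iter_imp imp k y z)) (imp x (iter_imp imp k y z)) = one"
    using assms by (simp add: imp_antimono)
  have 2: "imp (imp x (iter_imp imp k y z)) (imp x (iter_imp imp k x z)) = one"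
    using assms Suc by (simp add: imp_mono)
  show ?case
    using assms by (simp add: imp_trans[OF _ _ _ 1 2])
qed (use assms in simp)

lemma le_iter_imp:
  assumes "x \<in> A" "y \<in> A"
  shows "imp y (iter_imp imp k x y) = one"
  using assms iter_imp_add_one[of x one 0 k] by (subst iter_imp_exchange) simp_all

section \<open>Prime deductive systems\<close>

definition deductive :: "'a set \<Rightarrow> bool" where
  "deductive F \<longleftrightarrow> F \<subseteq> A \<and> one \<in> F \<and> (\<forall>x\<in>F. \<forall>y\<in>A. imp x y \<in> F \<longrightarrow> y \<in> F)"

lemma deductive_mp: "deductive F \<Longrightarrow> x \<in> F \<Longrightarrow> imp x y \<in> F \<Longrightarrow> y \<in> A \<Longrightarrow> y \<in> F"
  unfolding deductive_def by blast

lemma deductive_one: "deductive F \<Longrightarrow> one \<in> F"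
  unfolding deductive_def by blast

lemma deductive_subset: "deductive F \<Longrightarrow> F \<subseteq> A"
  unfolding deductive_def by blast

lemma deductive_up: "deductive F \<Longrightarrow> x \<in> F \<Longrightarrow> imp x y = one \<Longrightarrow> y \<in> A \<Longrightarrow> y \<in> F"
  by (rule deductive_mp[of F x]) (simp_all add: deductive_one)

lemma deductive_trans:
  assumes F: "deductive F" and "x \<in> A" "y \<in> A" "z \<in> A" "imp x y \<in> F" "imp y z \<in> F"
  shows "imp x z \<in> F"
proof -
  have "imp (imp y z) (imp x z) \<in> F"
    by - (rule deductive_up[OF F, of "imp x y"], use assms in \<open>simp_all add: transitivity\<close>)
  then show ?thesis
    by - (rule deductive_mp[OF F, of "imp y z"], use assms in simp_all)
qed

text \<open>
  Reasoning by cases in a deductive system: both \<open>p\<close> and \<open>q\<close> lie below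
  \<open>(p \<rightarrowtail> z) \<rightarrowtail> ((q \<rightarrowtail> z) \<rightarrowtail> z)\<close>, so this element is \<open>1\<close> as soon as \<open>p \<or> q = 1\<close>.
\<close>
lemma deductive_join:
  assumes F: "deductive F" and A: "p \<in> A" "q \<in> A" "z \<in> A"
    and pq: "imp (imp p q) q = one" and "imp p z \<in> F" "imp q z \<in> F"
  shows "z \<in> F"
proof -
  let ?r = "imp (imp q z) z"
  let ?w = "imp (imp p z) ?r"
  have "imp p ?w = one"
  proof (rule imp_trans)
    show "imp p (imp (imp p z) z) = one"
      using A by (simp add: le_join)
    show "imp (imp (imp p z) z) ?w = one"
      using A by (simp add: imp_mono weakening)
  qed (use A in simp_all)
  moreover have "imp q ?w = one"
  proof (rule imp_trans)
    show "imp q ?r = one"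
      using A by (simp add: le_join)
    show "imp ?r ?w = one"
      using A by (simp add: weakening)
  qed (use A in simp_all)
  ultimately have "imp (imp (imp p q) q) ?w = one"
    using A by (intro join_least) simp_all
  then have "?w \<in> F"
    using A F pq deductive_one by simp
  then have "?r \<in> F"
    by - (rule deductive_mp[OF F, of "imp p z" ?r], use assms in \<open>simp_all\<close>)
  then show ?thesis
    by - (rule deductive_mp[OF F, of "imp q z" z], use assms in \<open>simp_all\<close>)
qed

text \<open>
  The same for iterated premises, removing one copy of \<open>p\<close> or \<open>q\<close> at a time; this is the form
  in which maximality of a deductive system delivers the premises.
\<close>
lemma deductive_join_iter:
  assumes F: "deductive F" and A: "p \<in> A" "q \<in> A" and pq: "imp (imp p q) q = one"
    and "a \<in> A" "iter_imp imp k p a \<in> F" "iter_imp imp l q a \<in> F"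
  shows "a \<in> F"
proof -
  have single: "b \<in> F" if "b \<in> A" "imp q b \<in> F" "iter_imp imp k p b \<in> F" for b k
    using that
  proof (induction k)
    case (Suc k)
    let ?z = "iter_imp imp k p b"
    have "imp (imp q b) (imp q ?z) = one"
      using A Suc.prems by (simp add: imp_mono le_iter_imp)
    then have "imp q ?z \<in> F"
      by - (rule deductive_up[OF F, of "imp q b"], use A Suc.prems in \<open>simp_all\<close>)
    then have "?z \<in> F"
      by - (rule deductive_join[OF F A _ pq], use A Suc.prems in simp_all)
    then show ?case
      using Suc by simp
  qed simp
  show ?thesis
    using assms(5-7)
  proof (induction l)
    case (Suc l)
    let ?b = "iter_imp imp l q a"
    have "imp (iter_imp imp k p a) (iter_imp imp k p ?b) = one"
      using A Suc.prems by (simp add: iter_imp_mono le_iter_imp)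
    then have "iter_imp imp k p ?b \<in> F"
      by - (rule deductive_up[OF F, of "iter_imp imp k p a"], use A Suc.prems in \<open>simp_all\<close>)
    then have "?b \<in> F"
      by - (rule single, use A Suc.prems in simp_all)
    then show ?case
      using Suc by simp
  qed simp
qed

text \<open>
  This is the deductive system generated by \<open>F\<close> and \<open>p\<close>.  It is closed under modus ponens because
  exponents add: \<open>p \<rightarrow>\<^sub>k x\<close> and \<open>p \<rightarrow>\<^sub>l (x \<rightarrowtail> y)\<close> in \<open>F\<close> put \<open>p \<rightarrow>\<^sub>k\<^sub>+\<^sub>l y\<close> into \<open>F\<close>.
\<close>
lemma deductive_extension:
  assumes F: "deductive F" and p: "p \<in> A"
  defines "G \<equiv> {y \<in> A. \<exists>k. iter_imp imp k p y \<in> F}"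
  shows "deductive G" "F \<subseteq> G" "p \<in> G"
proof -
  have FA: "F \<subseteq> A" and one: "one \<in> F"
    using F by (simp_all add: deductive_subset deductive_one)
  have "y \<in> G" if xy: "x \<in> G" "imp x y \<in> G" "y \<in> A" for x y
  proof -
    obtain k l where kl: "x \<in> A" "iter_imp imp k p x \<in> F" "iter_imp imp l p (imp x y) \<in> F"
      using xy by (auto simp: G_def)
    have eq: "iter_imp imp l p (imp x y) = imp x (iter_imp imp l p y)"
      using kl p that by (simp add: iter_imp_exchange)
    have shift: "imp (imp x w) (imp (iter_imp imp k p x) (iter_imp imp k p w)) = one"
      if "w \<in> A" for w
    proof (induction k)
      case (Suc k)
      have 1: "imp (imp (iter_imp imp k p x) (iter_imp imp k p w))
          (imp (imp p (iter_imp imp k p x)) (imp p (iter_imp imp k p w))) = one"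
        using that p kl
        by (subst exchange) (simp_all add: transitivity)
      then show ?case
        using that p kl by (simp add: imp_trans[OF _ _ _ Suc 1])
    qed (use that kl in simp)
    have "imp (iter_imp imp k p x) (iter_imp imp k p (iter_imp imp l p y)) \<in> F"
      by - (rule deductive_up[OF F, of "iter_imp imp l p (imp x y)"],
        use kl p that shift[of "iter_imp imp l p y"] eq in \<open>simp_all\<close>)
    then have "iter_imp imp (k + l) p y \<in> F"
      by - (rule deductive_mp[OF F, of "iter_imp imp k p x"],
        use kl p that in \<open>simp_all add: iter_imp_add\<close>)
    then show ?thesis
      using that by (auto simp: G_def)
  qed
  moreover have FG: "F \<subseteq> G"
    using FA by (auto simp: G_def intro!: exI[of _ 0])
  moreover have "G \<subseteq> A"
    by (auto simp: G_def)
  ultimately show "deductive G"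
    using one unfolding deductive_def by blast
  show "F \<subseteq> G" by fact
  show "p \<in> G"
    using p one by (auto simp: G_def intro!: exI[of _ 1])
qed

text \<open>
  A deductive system maximal among those missing \<open>a\<close> is prime: if neither \<open>x \<rightarrowtail> y\<close> nor \<open>y \<rightarrowtail> x\<close>
  belonged to it, adjoining either one would produce \<open>a\<close>; but the join of the two is \<open>1\<close> by
  prelinearity, so \<open>a\<close> would be there already.
\<close>
lemma prime_deductive_exists:
  assumes a: "a \<in> A" "a \<noteq> one"
  obtains F where "deductive F" "a \<notin> F" "\<And>x y. x \<in> A \<Longrightarrow> y \<in> A \<Longrightarrow> imp x y \<in> F \<or> imp y x \<in> F"
proof -
  let ?S = "{F. deductive F \<and> a \<notin> F}"
  have "\<exists>M\<in>?S. \<forall>X\<in>?S. M \<subseteq> X \<longrightarrow> X = M"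
  proof (rule subset_Zorn_nonempty)
    have "deductive {one}"
      by (auto simp: deductive_def)
    then show "?S \<noteq> {}"
      using a by auto
  next
    fix C assume C: "C \<noteq> {}" "subset.chain ?S C"
    then have ded: "\<And>F. F \<in> C \<Longrightarrow> deductive F" "\<And>F. F \<in> C \<Longrightarrow> a \<notin> F"
      and lin: "\<And>F G. F \<in> C \<Longrightarrow> G \<in> C \<Longrightarrow> F \<subseteq> G \<or> G \<subseteq> F"
      by (auto simp: subset_chain_def)
    have "y \<in> \<Union>C" if xy: "x \<in> \<Union>C" "imp x y \<in> \<Union>C" "y \<in> A" for x y
    proof -
      obtain F G where FG: "F \<in> C" "G \<in> C" "x \<in> F" "imp x y \<in> G"
        using xy by auto
      then obtain H where "H \<in> C" "x \<in> H" "imp x y \<in> H"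
        using lin[of F G] by blast
      then show ?thesis
        using ded(1) xy deductive_mp by blast
    qed
    moreover have "one \<in> \<Union>C" "\<Union>C \<subseteq> A"
      using C(1) ded(1) deductive_one deductive_subset by blast+
    ultimately have "deductive (\<Union>C)"
      unfolding deductive_def by blast
    then show "\<Union>C \<in> ?S"
      using ded(2) by blast
  qed
  then obtain F where F: "deductive F" "a \<notin> F"
    and max: "\<And>G. deductive G \<Longrightarrow> a \<notin> G \<Longrightarrow> F \<subseteq> G \<Longrightarrow> G = F"
    by auto
  have gen: "\<exists>k. iter_imp imp k p a \<in> F" if "p \<in> A" "p \<notin> F" for p
    using deductive_extension[OF F(1) that(1)] max that(2) by blast
  show ?thesis
  proof (rule that[OF F])
    fix x y assume xy: "x \<in> A" "y \<in> A"
    show "imp x y \<in> F \<or> imp y x \<in> F"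
    proof (rule ccontr)
      assume "\<not> ?thesis"
      then obtain k l where "iter_imp imp k (imp x y) a \<in> F" "iter_imp imp l (imp y x) a \<in> F"
        using gen[of "imp x y"] gen[of "imp y x"] xy by auto
      then have "a \<in> F"
        by - (rule deductive_join_iter[OF F(1), of "imp x y" "imp y x"],
          use xy a in \<open>simp_all add: prelinearity\<close>)
      then show False
        using F by simp
    qed
  qed
qed

end

lemma (in n_valued_lukasiewicz_residuation_algebra) n_valued_image:
  assumes hom: "\<And>x y. x \<in> A \<Longrightarrow> y \<in> A \<Longrightarrow> imp' (h x) (h y) = h (imp x y)"
  shows "n_valued_lukasiewicz_residuation_algebra (h ` A) imp' (h one) n"
proof -
  have iter: "iter_imp imp' k (h x) (h y) = h (iter_imp imp k x y)" if "x \<in> A" "y \<in> A" for k x y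
    using that by (induction k) (simp_all add: hom)
  show ?thesis
    by unfold_locales
      (auto simp: hom iter join_def weakening transitivity prelinearity commutation
        n_valued[unfolded join_def] simp del: One_nat_def)
qed

section \<open>Totally ordered algebras\<close>

locale n_valued_chain = n_valued_lukasiewicz_residuation_algebra +
  assumes total: "x \<in> A \<Longrightarrow> y \<in> A \<Longrightarrow> imp x y = one \<or> imp y x = one"
begin

text \<open>In a chain a join can only be \<open>1\<close> if one of the two elements is.\<close>
lemma iter_imp_eq_one:
  assumes "x \<in> A" "y \<in> A" "x \<noteq> one"
  shows "iter_imp imp (n - 1) x y = one"
proof (rule ccontr)
  let ?w = "iter_imp imp (n - 1) x y"
  assume w: "?w \<noteq> one"
  have j: "imp (imp ?w x) x = one"
    using assms n_valued[of x y] by (simp add: join_def)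
  have "imp ?w x = one \<or> imp x ?w = one"
    using total assms by simp
  then show False
  proof
    assume "imp ?w x = one"
    then show False
      using j assms by simp
  next
    assume "imp x ?w = one"
    then have "imp (imp ?w x) x = ?w"
      using assms by (simp add: join_absorb)
    then show False
      using j w by simp
  qed
qed

text \<open>
  In terms of distances from the top this says \<open>y - x = (y - e) - (x - e)\<close> for \<open>x, y\<close> below \<open>e\<close>;
  it drives the induction that computes the distance of an implication.
\<close>
lemma imp_shift:
  assumes "e \<in> A" "x \<in> A" "y \<in> A" "imp x e = one" "imp y e = one"
  shows "imp x y = imp (imp e x) (imp e y)"
  using total[OF assms(2,3)]
proof
  assume "imp x y = one"
  then show ?thesis
    using assms by (simp add: imp_mono)
next
  assume yx: "imp y x = one"
  let ?u = "imp x y"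
  have x: "x = imp ?u y"
    using assms yx by (simp add: join_absorb)
  then have "imp e x = imp ?u (imp e y)"
    using assms by (subst exchange) simp_all
  then have "imp (imp e x) (imp e y) = imp (imp (imp e y) ?u) ?u"
    using assms by (simp add: commutation)
  also have "imp (imp e y) ?u = one"
    using assms by (simp add: imp_antimono)
  finally show ?thesis
    using assms by simp
qed

text \<open>
  If no \<open>y \<noteq> 1\<close> were a coatom, one could start at \<open>b\<close> and climb forever without reaching \<open>1\<close>,
  replacing \<open>y\<close> by \<open>x \<rightarrowtail> y\<close> with \<open>y < x < 1\<close>.  Replacing the elements \<open>x\<close> used in \<open>k\<close> steps by
  their maximum \<open>z\<close> shows that \<open>z \<rightarrowtail> (z \<rightarrowtail> \<dots> b)\<close> is still not \<open>1\<close>, against \<open>n\<close>-valuedness once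
  \<open>k = n - 1\<close>.
\<close>
lemma coatom_exists:
  assumes "b \<in> A" "b \<noteq> one"
  obtains e where "e \<in> A" "e \<noteq> one" "\<And>x. x \<in> A \<Longrightarrow> x \<noteq> one \<Longrightarrow> imp x e = one"
proof -
  have "\<exists>e\<in>A - {one}. \<forall>x\<in>A - {one}. imp x e = one"
  proof (rule ccontr)
    assume "\<not> ?thesis"
    then have step: "\<exists>x\<in>A - {one}. imp x y \<noteq> one" if "y \<in> A - {one}" for y
      using that by blast
    have "\<exists>y\<in>A - {one}. \<exists>z\<in>A - {one}. imp (iter_imp imp k z b) y = one" for k
    proof (induction k)
      case 0
      show ?case
        using assms by (auto intro!: bexI[of _ b])
    next
      case (Suc k)
      then obtain y z where yz: "y \<in> A" "y \<noteq> one" "z \<in> A" "z \<noteq> one" "imp (iter_imp imp k z b) y = one"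
        by auto
      obtain x where x: "x \<in> A" "x \<noteq> one" "imp x y \<noteq> one"
        using step yz by auto
      \<comment> \<open>the larger of \<open>x\<close> and \<open>z\<close>\<close>
      obtain w where w: "w \<in> A" "w \<noteq> one" "imp x w = one" "imp z w = one"
        using total[of x z] x yz by (metis imp_refl)
      have "imp (iter_imp imp k w b) y = one"
        using w yz assms by (simp add: imp_trans[OF _ _ _ iter_imp_antimono[of z w] yz(5)])
      then have 1: "imp (imp w (iter_imp imp k w b)) (imp w y) = one"
        using w yz assms by (simp add: imp_mono)
      have 2: "imp (imp w y) (imp x y) = one"
        using w yz x by (simp add: imp_antimono)
      have "imp (iter_imp imp (Suc k) w b) (imp x y) = one"
        using w yz x assms by (simp add: imp_trans[OF _ _ _ 1 2])
      then show ?case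
        using w x yz by (intro bexI[of _ "imp x y"] bexI[of _ w]) auto
    qed
    from this[of "n - 1"] show False
      using iter_imp_eq_one assms(1) by auto
  qed
  then show ?thesis
    using that by auto
qed

text \<open>
  The rank of \<open>y\<close> is the number of implications by the coatom \<open>e\<close> needed to raise \<open>y\<close> to \<open>1\<close>.  One
  implication by \<open>e\<close> lowers a positive rank by one, so \<open>imp_shift\<close> reduces \<open>x \<rightarrowtail> y\<close> to elements
  of smaller rank.
\<close>
lemma chain_rank:
  obtains v :: "'a \<Rightarrow> nat" where
    "\<And>x y. x \<in> A \<Longrightarrow> y \<in> A \<Longrightarrow> v (imp x y) = v y - v x"
    "\<And>x. x \<in> A \<Longrightarrow> v x = 0 \<longleftrightarrow> x = one"
    "\<And>x. x \<in> A \<Longrightarrow> v x \<le> n - 1"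
proof (cases "A = {one}")
  case True
  then show ?thesis
    using that[of "\<lambda>_. 0"] by auto
next
  case False
  then obtain b where "b \<in> A" "b \<noteq> one"
    using one_closed by auto
  then obtain e where e: "e \<in> A" "e \<noteq> one" "\<And>x. x \<in> A \<Longrightarrow> x \<noteq> one \<Longrightarrow> imp x e = one"
    using coatom_exists by metis
  define v where "v y = (LEAST k. iter_imp imp k e y = one)" for y
  have v_one: "iter_imp imp (v y) e y = one" if "y \<in> A" for y
    unfolding v_def using iter_imp_eq_one[of e y] e that by (intro LeastI) auto
  have v_le: "v y \<le> k" if "iter_imp imp k e y = one" for y k
    unfolding v_def using that by (rule Least_le)
  have v0: "v x = 0 \<longleftrightarrow> x = one" if "x \<in> A" for x
    using v_one[OF that] v_le[of 0 x] by auto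
  have iter_shift: "iter_imp imp (Suc k) e y = iter_imp imp k e (imp e y)" for k y
    by (simp add: iter_imp_def funpow_swap1)
  have v_step: "v (imp e y) = v y - 1" if "y \<in> A" for y
  proof (cases "v y")
    case 0
    then have "imp e y = y"
      using v0 that e by simp
    then show ?thesis
      using 0 by simp
  next
    case (Suc k)
    have "v (imp e y) \<le> k"
      using v_one[OF that] by (intro v_le) (metis Suc iter_shift)
    moreover have "v y \<le> Suc (v (imp e y))"
      using v_one[of "imp e y"] that e by (intro v_le) (metis iter_shift imp_closed)
    ultimately show ?thesis
      using Suc by simp
  qed
  have "v (imp x y) = v y - v x" if "x \<in> A" "y \<in> A" for x y
    using that
  proof (induction "v x" arbitrary: x y)
    case 0
    have "v x = 0"
      using 0(1) by (rule HOL.sym)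
    moreover from this have "x = one"
      using v0 0(2) by blast
    ultimately show ?case
      using 0(3) by simp
  next
    case (Suc k)
    have vx: "v x = Suc k"
      using Suc.hyps(2) by (rule HOL.sym)
    then have x: "x \<noteq> one"
      using v0[OF Suc.prems(1)] by simp
    show ?case
    proof (cases "y = one")
      case True
      then show ?thesis
        using v0[of one] Suc.prems(1) by simp
    next
      case False
      have "imp x y = imp (imp e x) (imp e y)"
        using e x False Suc.prems by (intro imp_shift) auto
      moreover have "v (imp (imp e x) (imp e y)) = v (imp e y) - v (imp e x)"
        using v_step[OF Suc.prems(1)] vx e Suc.prems by (intro Suc.hyps(1)) simp_all
      ultimately show ?thesis
        using v_step[OF Suc.prems(1)] v_step[OF Suc.prems(2)] vx by simp
    qed
  qed
  moreover have "v x \<le> n - 1" if "x \<in> A" for x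
    using iter_imp_eq_one[of e x] e that by (intro v_le) auto
  ultimately show ?thesis
    using that v0 by blast
qed

end

section \<open>Separation by finite Lukasiewicz chains\<close>

text \<open>
  The rank of the chain obtained by factoring out a prime deductive system missing \<open>a\<close>.  The
  quotient is realised on chosen representatives, so that its elements have the type of the
  given algebra.
\<close>

lemma (in n_valued_lukasiewicz_residuation_algebra) separating_rank:
  assumes a: "a \<in> A" "a \<noteq> one"
  obtains v :: "'a \<Rightarrow> nat" where
    "\<And>x y. x \<in> A \<Longrightarrow> y \<in> A \<Longrightarrow> v (imp x y) = v y - v x"
    "v one = 0" "v a \<noteq> 0" "\<And>x. x \<in> A \<Longrightarrow> v x \<le> n - 1"
proof -
  obtain F where F: "deductive F" "a \<notin> F"
    and prime: "\<And>x y. x \<in> A \<Longrightarrow> y \<in> A \<Longrightarrow> imp x y \<in> F \<or> imp y x \<in> F"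
    using prime_deductive_exists[OF a] by blast
  have one: "one \<in> F"
    using F(1) by (rule deductive_one)
  define E where "E x y \<longleftrightarrow> imp x y \<in> F \<and> imp y x \<in> F" for x y
  define h where "h x = (SOME y. y \<in> A \<and> E x y)" for x
  have E_refl: "E x x" if "x \<in> A" for x
    using that one by (simp add: E_def)
  have E_sym: "E x y \<Longrightarrow> E y x" for x y
    by (simp add: E_def)
  have E_trans: "E x z" if "E x y" "E y z" "x \<in> A" "y \<in> A" "z \<in> A" for x y z
    using that deductive_trans[OF F(1)] unfolding E_def by blast
  have h: "h x \<in> A" "E x (h x)" if "x \<in> A" for x
    using someI[of "\<lambda>y. y \<in> A \<and> E x y" x] that E_refl by (auto simp: h_def)
  have h_cong: "h x = h y" if "E x y" "x \<in> A" "y \<in> A" for x y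
  proof -
    have "(\<lambda>z. z \<in> A \<and> E x z) = (\<lambda>z. z \<in> A \<and> E y z)"
      using that E_trans E_sym by blast
    then show ?thesis
      by (simp add: h_def)
  qed
  have E_imp: "E (imp x y) (imp x' y')"
    if "E x x'" "E y y'" "x \<in> A" "x' \<in> A" "y \<in> A" "y' \<in> A" for x y x' y'
  proof -
    have left: "imp (imp x y) (imp x' y) \<in> F" if "imp x' x \<in> F" "x \<in> A" "x' \<in> A" "y \<in> A" for x x' y
      by - (rule deductive_up[OF F(1) that(1)], use that in \<open>simp_all add: transitivity\<close>)
    have right: "imp (imp x y) (imp x y') \<in> F" if "imp y y' \<in> F" "x \<in> A" "y' \<in> A" "y \<in> A" for x y y'
    proof (rule deductive_up[OF F(1) that(1)])
      show "imp (imp y y') (imp (imp x y) (imp x y')) = one"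
        using that by (subst exchange) (simp_all add: transitivity)
    qed (use that in simp)
    have "E (imp x y) (imp x' y)" "E (imp x' y) (imp x' y')"
      using that left right by (auto simp: E_def)
    then show ?thesis
      using that E_trans by (meson imp_closed)
  qed
  define imp' where "imp' u w = h (imp u w)" for u w
  have hom: "imp' (h x) (h y) = h (imp x y)" if "x \<in> A" "y \<in> A" for x y
    unfolding imp'_def using that h E_sym by (simp add: h_cong E_imp)
  have h_one: "h x = h one \<longleftrightarrow> x \<in> F" if "x \<in> A" for x
  proof
    assume "x \<in> F"
    then show "h x = h one"
      using that one by (intro h_cong) (auto simp: E_def)
  next
    assume "h x = h one"
    then have "E x one"
      using h[of x] h[of one] that E_trans E_sym by (metis one_closed)
    then show "x \<in> F"
      using that by (simp add: E_def)
  qed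
  interpret Q: n_valued_chain "h ` A" imp' "h one" n
    by (intro n_valued_chain.intro n_valued_chain_axioms.intro n_valued_image hom)
      (auto simp: hom h_one, use prime in blast)
  obtain v where v: "\<And>x y. x \<in> h ` A \<Longrightarrow> y \<in> h ` A \<Longrightarrow> v (imp' x y) = v y - v x"
    "\<And>x. x \<in> h ` A \<Longrightarrow> v x = 0 \<longleftrightarrow> x = h one"
    "\<And>x. x \<in> h ` A \<Longrightarrow> v x \<le> n - 1"
    using Q.chain_rank by metis
  show ?thesis
  proof (rule that[of "v \<circ> h"])
    show "(v \<circ> h) (imp x y) = (v \<circ> h) y - (v \<circ> h) x" if "x \<in> A" "y \<in> A" for x y
      using v(1)[of "h x" "h y"] that by (simp add: hom)
    show "(v \<circ> h) a \<noteq> 0"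
      using v(2)[of "h a"] a h_one F(2) by simp
  qed (use v in auto)
qed

text \<open>
  The chain \<open>{0, 1/N, \<dots>, 1}\<close>, with \<open>k\<close> standing for the truth value \<open>1 - k/N\<close>; thus \<open>0\<close> is the
  top and \<open>N\<close> the bottom.
\<close>
definition lukasiewicz_chain :: "nat \<Rightarrow> nat dl_algebra" where
  "lukasiewicz_chain N = \<lparr>dl_carrier = {0..N}, dl_imp = (\<lambda>x y. y - x),
     dl_delta = (\<lambda>x. if x = 0 then 0 else N), dl_one = 0\<rparr>"

lemma lukasiewicz_chain_sel [simp]:
  "dl_carrier (lukasiewicz_chain N) = {0..N}"
  "dl_imp (lukasiewicz_chain N) = (\<lambda>x y. y - x)"
  "dl_delta (lukasiewicz_chain N) = (\<lambda>x. if x = 0 then 0 else N)"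
  "dl_one (lukasiewicz_chain N) = 0"
  by (simp_all add: lukasiewicz_chain_def)

lemma iter_monus: "iter_imp (\<lambda>x y. y - x) k x y = y - k * (x::nat)"
  by (induction k) auto

lemma lukasiewicz_chain_in_variety:
  assumes "n \<ge> 2" "N \<le> n - 1"
  shows "delta_lukasiewicz_residuation_algebra (lukasiewicz_chain N) n"
proof -
  have full: "y \<le> (n - 1) * x" if "y \<le> N" "x \<noteq> 0" for x y :: nat
  proof -
    have "y \<le> (n - 1) * 1" using that assms by simp
    also have "\<dots> \<le> (n - 1) * x" using that by (intro mult_le_mono) auto
    finally show ?thesis .
  qed
  have full': "x \<le> x - (y - (n - 1) * x)" if "y \<le> N" for x y :: nat
    using full[OF that, of x] by (cases "x = 0") simp_all
  show ?thesis
    by unfold_locales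
      (auto simp: iter_monus join_def full full' assms simp del: One_nat_def)
qed

text \<open>
  A separating rank \<open>v\<close> automatically respects \<open>\<Delta>\<close>; differences are truncated.  If \<open>v x \<noteq> 0\<close>, then \<open>n\<close>-valuedness gives
  \<open>0 = v (x \<rightarrow>\<^sub>n\<^sub>-\<^sub>1 y) = v y - v (\<Delta>x)\<close> for all \<open>y\<close>, so \<open>v (\<Delta>x)\<close> is the largest value of \<open>v\<close>, and
  this value serves as \<open>N\<close>; if \<open>v x = 0\<close>, then \<open>v (\<Delta>x)\<close> equals \<open>v (\<Delta>x \<rightarrowtail> \<Delta>x) = 0\<close>.
\<close>
lemma (in delta_lukasiewicz_residuation_algebra) separating_chain_hom:
  assumes a: "a \<in> dl_carrier B" "a \<noteq> dl_one B"
  obtains N v where "1 \<le> N" "N \<le> n - 1" "dl_hom B (lukasiewicz_chain N) v" "v a \<noteq> 0"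
proof -
  obtain v :: "'a \<Rightarrow> nat" where v:
    "\<And>x y. x \<in> dl_carrier B \<Longrightarrow> y \<in> dl_carrier B \<Longrightarrow> v (dl_imp B x y) = v y - v x"
    "v (dl_one B) = 0" "v a \<noteq> 0" "\<And>x. x \<in> dl_carrier B \<Longrightarrow> v x \<le> n - 1"
    using separating_rank[OF a] by blast
  have v_iter: "v (iter_imp (dl_imp B) k x y) = v y - k * v x"
    if "x \<in> dl_carrier B" "y \<in> dl_carrier B" for k x y
    using that by (induction k) (simp_all add: v)
  have bot: "v y \<le> v (dl_delta B x)"
    if x: "x \<in> dl_carrier B" and y: "y \<in> dl_carrier B" and vx: "v x \<noteq> 0" for x y
  proof -
    let ?w = "iter_imp (dl_imp B) (n - 1) x y"
    have w: "?w \<in> dl_carrier B"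
      using x y by (rule iter_imp_closed)
    have "v x - (v x - v ?w) = v (join (dl_imp B) ?w x)"
      unfolding join_def by (simp only: v(1) w x imp_closed)
    also have "\<dots> = 0"
      by (simp only: n_valued[OF x y] v(2))
    finally have "v ?w = 0"
      using vx by simp
    moreover have "v ?w = v y - v (dl_delta B x)"
      by (simp only: delta_imp[OF x y, symmetric] v(1)[OF delta_closed[OF x] y])
    ultimately show ?thesis
      by simp
  qed
  let ?N = "v (dl_delta B a)"
  have top: "v (dl_delta B x) = 0" if x: "x \<in> dl_carrier B" and vx: "v x = 0" for x
  proof -
    note D = delta_closed[OF x]
    have "v (dl_delta B x) = v (iter_imp (dl_imp B) (n - 1) x (dl_delta B x))"
      by (simp only: v_iter[OF x D] vx mult_0_right diff_zero)
    also have "\<dots> = v (dl_imp B (dl_delta B x) (dl_delta B x))"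
      by (simp only: delta_imp[OF x D])
    also have "\<dots> = 0"
      by (simp only: imp_refl[OF D] v(2))
    finally show ?thesis .
  qed
  have full: "v (dl_delta B x) = ?N" if "x \<in> dl_carrier B" "v x \<noteq> 0" for x
    using bot[OF that(1) delta_closed[OF a(1)] that(2)] bot[OF a(1) delta_closed[OF that(1)] v(3)]
    by (rule antisym[rotated])
  have N: "v x \<le> ?N" if "x \<in> dl_carrier B" for x
    using bot[OF a(1) that v(3)] .
  have "dl_hom B (lukasiewicz_chain ?N) v"
    unfolding dl_hom_def lukasiewicz_chain_sel using N top full v(1,2) by simp
  moreover have "1 \<le> ?N"
    using N[OF a(1)] v(3) by simp
  moreover have "?N \<le> n - 1"
    by (rule v(4)[OF delta_closed[OF a(1)]])
  ultimately show ?thesis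
    using that v(3) by blast
qed

text \<open>
  Completeness of the finite chains for the equational theory: if \<open>s \<rightarrowtail> t\<close> or \<open>t \<rightarrowtail> s\<close> is not \<open>1\<close> in
  the free algebra, a homomorphism to a chain separating it from \<open>1\<close> restricts to a valuation of
  the generators at which \<open>s\<close> and \<open>t\<close> differ.
\<close>
lemma dl_eq_iff_eval:
  assumes n: "n \<ge> 2" and st: "s \<in> dl_terms X" "t \<in> dl_terms X"
  shows "dl_eq n X s t \<longleftrightarrow> (\<forall>N\<in>{1..n - 1}. \<forall>f\<in>X \<rightarrow> {0..N}.
    dl_eval (lukasiewicz_chain N) f s = dl_eval (lukasiewicz_chain N) f t)"
proof
  assume eq: "dl_eq n X s t"
  show "\<forall>N\<in>{1..n - 1}. \<forall>f\<in>X \<rightarrow> {0..N}.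
    dl_eval (lukasiewicz_chain N) f s = dl_eval (lukasiewicz_chain N) f t"
  proof (intro ballI)
    fix N f assume N: "N \<in> {1..n - 1}" and f: "f \<in> X \<rightarrow> {0..N}"
    show "dl_eval (lukasiewicz_chain N) f s = dl_eval (lukasiewicz_chain N) f t"
    proof (rule dl_eval_sound(2)[OF _ _ eq])
      show "delta_lukasiewicz_residuation_algebra (lukasiewicz_chain N) n"
        using N by (intro lukasiewicz_chain_in_variety n) simp
    qed (use f in \<open>auto simp: Pi_iff\<close>)
  qed
next
  assume eq: "\<forall>N\<in>{1..n - 1}. \<forall>f\<in>X \<rightarrow> {0..N}.
    dl_eval (lukasiewicz_chain N) f s = dl_eval (lukasiewicz_chain N) f t"
  interpret F: delta_lukasiewicz_residuation_algebra "free_dl_algebra n X" n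
    by (rule free_dl_algebra_in_variety[OF n])
  let ?c = "dl_class n X"
  have le: "?c (Imp p q) = ?c One"
    if p: "p \<in> dl_terms X" and q: "q \<in> dl_terms X"
      and pq: "\<forall>N\<in>{1..n - 1}. \<forall>f\<in>X \<rightarrow> {0..N}.
        dl_eval (lukasiewicz_chain N) f p = dl_eval (lukasiewicz_chain N) f q" for p q
  proof (rule ccontr)
    assume ne: "?c (Imp p q) \<noteq> ?c One"
    have "?c (Imp p q) \<in> dl_carrier (free_dl_algebra n X)"
      using p q by (simp add: free_carrier)
    from F.separating_chain_hom[OF this, unfolded free_one, OF ne]
    obtain N v where N: "1 \<le> N" "N \<le> n - 1"
      and v: "dl_hom (free_dl_algebra n X) (lukasiewicz_chain N) v" "v (?c (Imp p q)) \<noteq> 0" .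
    define f where "f x = v (?c (Gen x))" for x
    have vc: "v (?c t) = dl_eval (lukasiewicz_chain N) f t" if "t \<in> dl_terms X" for t
      using that
    proof (induction t)
      case (Imp t u)
      then show ?case
        using v(1) by (auto simp: dl_hom_def free_carrier simp flip: free_imp)
    next
      case (Delta t)
      then show ?case
        using v(1) by (auto simp: dl_hom_def free_carrier simp flip: free_delta)
    next
      case One
      then show ?case
        using v(1) by (simp add: dl_hom_def free_one)
    qed (simp add: f_def)
    have "f \<in> X \<rightarrow> {0..N}"
      using v(1) by (auto simp: dl_hom_def free_carrier f_def)
    then have "dl_eval (lukasiewicz_chain N) f p = dl_eval (lukasiewicz_chain N) f q"
      using pq N by simp
    then show False
      using v(2) vc[of "Imp p q"] p q by simp
  qed
  have "?c s = ?c t"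
  proof (rule F.imp_antisym)
    show "dl_imp (free_dl_algebra n X) (?c s) (?c t) = dl_one (free_dl_algebra n X)"
      using le[OF st eq] st by (simp only: free_imp free_one)
    have "dl_eval (lukasiewicz_chain N) f t = dl_eval (lukasiewicz_chain N) f s"
      if "N \<in> {1..n - 1}" "f \<in> X \<rightarrow> {0..N}" for N f
      using eq that by metis
    then show "dl_imp (free_dl_algebra n X) (?c t) (?c s) = dl_one (free_dl_algebra n X)"
      using le[OF st(2,1)] st by (simp only: free_imp free_one) blast
  qed (use st in \<open>auto simp: free_carrier\<close>)
  then show "dl_eq n X s t"
    using st by (simp add: dl_class_eq_iff)
qed

section \<open>Primitive valuations\<close>

text \<open>
  The values of a valuation that is not identically \<open>0\<close>, together with the value \<open>N\<close> which \<open>\<Delta>\<close>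
  then produces, generate the multiples of their greatest common divisor.  The primitive valuations
  are therefore those that generate the whole chain, and the zero valuation for \<open>N = 1\<close>.
\<close>

definition primitive_valuations :: "'x set \<Rightarrow> nat \<Rightarrow> ('x \<Rightarrow> nat) set" where
  "primitive_valuations X N = {f \<in> X \<rightarrow>\<^sub>E {0..N}. Gcd (insert N (f ` X)) = 1}"

lemma primitive_reduction:
  assumes "N > 0" "f \<in> X \<rightarrow> {0..N}"
  obtains d e g where "N = d * e" "g \<in> primitive_valuations X e" "\<And>x. x \<in> X \<Longrightarrow> f x = d * g x"
proof -
  define d where "d = Gcd (insert N (f ` X))"
  define g where "g = (\<lambda>x\<in>X. f x div d)"
  have "d dvd N"
    unfolding d_def by (rule Gcd_dvd) simp
  then obtain e where e: "N = d * e" ..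
  have d: "d > 0"
    using e assms by (cases d) auto
  have fg: "f x = d * g x" if "x \<in> X" for x
  proof -
    have "d dvd f x"
      unfolding d_def by (rule Gcd_dvd) (use that in simp)
    then show ?thesis
      using that by (simp add: g_def)
  qed
  have "insert N (f ` X) = (*) d ` insert e (g ` X)"
    using e fg by (auto simp: image_iff)
  then have "d = d * Gcd (insert e (g ` X))"
    unfolding d_def by (metis Gcd_mult normalize_nat_def id_apply)
  then have "Gcd (insert e (g ` X)) = 1"
    using d by simp
  moreover have "g x \<le> e" if "x \<in> X" for x
  proof -
    have "d * g x \<le> d * e"
      using fg[OF that] e assms that by (auto simp: Pi_iff)
    then show ?thesis
      using d by simp
  qed
  ultimately have "g \<in> primitive_valuations X e"
    by (auto simp: primitive_valuations_def g_def)
  then show ?thesis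
    using that e fg by blast
qed

lemma eval_scale:
  assumes "\<And>x. x \<in> X \<Longrightarrow> f x = d * g x" "d > 0" "t \<in> dl_terms X"
  shows "dl_eval (lukasiewicz_chain (d * e)) f t = d * dl_eval (lukasiewicz_chain e) g t"
  using assms(3) by (induction t) (use assms in \<open>auto simp: diff_mult_distrib2\<close>)

definition valuations :: "nat \<Rightarrow> 'x set \<Rightarrow> (nat \<times> ('x \<Rightarrow> nat)) set" where
  "valuations n X = Sigma {1..n - 1} (primitive_valuations X)"

definition term_function :: "nat \<Rightarrow> 'x set \<Rightarrow> 'x dl_term \<Rightarrow> nat \<times> ('x \<Rightarrow> nat) \<Rightarrow> nat" where
  "term_function n X t = (\<lambda>(N, f) \<in> valuations n X. dl_eval (lukasiewicz_chain N) f t)"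

lemma dl_eq_iff_term_function:
  assumes n: "n \<ge> 2" and st: "s \<in> dl_terms X" "t \<in> dl_terms X"
  shows "dl_eq n X s t \<longleftrightarrow> term_function n X s = term_function n X t"
proof -
  have "dl_eval (lukasiewicz_chain N) f s = dl_eval (lukasiewicz_chain N) f t"
    if eq: "term_function n X s = term_function n X t"
      and N: "N \<in> {1..n - 1}" and f: "f \<in> X \<rightarrow> {0..N}" for N f
  proof -
    obtain d e g where deg: "N = d * e" "g \<in> primitive_valuations X e" "\<And>x. x \<in> X \<Longrightarrow> f x = d * g x"
      using primitive_reduction[OF _ f] N by auto
    have "d > 0" "e > 0"
      using N deg(1) by (auto intro!: Nat.gr0I)
    moreover have "e \<le> N"
      using \<open>d > 0\<close> deg(1) by simp
    ultimately have "(e, g) \<in> valuations n X"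
      using N deg(2) by (simp add: valuations_def)
    then have "dl_eval (lukasiewicz_chain e) g s = dl_eval (lukasiewicz_chain e) g t"
      using fun_cong[OF eq, of "(e, g)"] by (simp add: term_function_def)
    then show ?thesis
      using eval_scale[of X f d g _ e] deg st \<open>d > 0\<close> by simp
  qed
  moreover have "term_function n X s = term_function n X t"
    if "\<forall>N\<in>{1..n - 1}. \<forall>f\<in>X \<rightarrow> {0..N}.
      dl_eval (lukasiewicz_chain N) f s = dl_eval (lukasiewicz_chain N) f t"
    using that
    by (auto simp: term_function_def valuations_def primitive_valuations_def PiE_iff
        intro!: restrict_ext)
  ultimately show ?thesis
    unfolding dl_eq_iff_eval[OF assms] by blast
qed

lemma eval_le:
  assumes "f \<in> X \<rightarrow> {0..N}" "t \<in> dl_terms X"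
  shows "dl_eval (lukasiewicz_chain N) f t \<le> N"
  using assms(2) by (induction t) (use assms(1) in \<open>auto simp: Pi_iff\<close>)

section \<open>Term functions\<close>

text \<open>The witness is the rightmost variable of \<open>t\<close>.\<close>

lemma eval_zero_of_variable:
  assumes "X \<noteq> {}" "t \<in> dl_terms X"
  shows "\<exists>x\<in>X. \<forall>N f. f x = 0 \<longrightarrow> dl_eval (lukasiewicz_chain N) f t = 0"
  using assms(2)
proof (induction t)
  case (Imp t u)
  then obtain x where "x \<in> X" "\<forall>N f. f x = 0 \<longrightarrow> dl_eval (lukasiewicz_chain N) f u = 0"
    by auto
  then show ?case
    by (intro bexI[of _ x]) simp_all
next
  case (Delta t)
  then obtain x where "x \<in> X" "\<forall>N f. f x = 0 \<longrightarrow> dl_eval (lukasiewicz_chain N) f t = 0"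
    by auto
  then show ?case
    by (intro bexI[of _ x]) simp_all
qed (use assms(1) in auto)

text \<open>The Euclidean algorithm, with the least positive element of \<open>S\<close> as divisor.\<close>
lemma monus_closed_Gcd:
  fixes S :: "nat set"
  assumes closed: "\<And>a b. a \<in> S \<Longrightarrow> b \<in> S \<Longrightarrow> b - a \<in> S" and N: "N \<in> S" "N > 0"
  shows "Gcd S \<in> S"
proof -
  define e where "e = (LEAST k. k \<in> S \<and> k > 0)"
  have e: "e \<in> S" "e > 0"
    using LeastI[of "\<lambda>k. k \<in> S \<and> k > 0" N] N by (auto simp: e_def)
  have least: "k = 0" if "k \<in> S" "k < e" for k
    using not_less_Least[of k "\<lambda>k. k \<in> S \<and> k > 0"] that by (auto simp: e_def)
  have "e dvd y" if "y \<in> S" for y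
  proof -
    have "y - k * e \<in> S" for k
    proof (induction k)
      case (Suc k)
      then have "(y - k * e) - e \<in> S"
        using closed e by blast
      then show ?case
        by (simp add: add.commute)
    qed (use that in simp)
    from this[of "y div e"] have "y mod e \<in> S"
      by (simp only: minus_div_mult_eq_mod)
    then have "y mod e = 0"
      by (rule least) (use e in simp)
    then show ?thesis
      by (rule mod_0_imp_dvd)
  qed
  then have "Gcd S = e"
    using e(1) by (intro dvd_antisym Gcd_greatest Gcd_dvd)
  then show ?thesis
    using e by simp
qed

lemma valuationsD:
  assumes "(N, f) \<in> valuations n X"
  shows "f \<in> X \<rightarrow> {0..N}" "f \<in> extensional X" "N > 0" "Gcd (insert N (f ` X)) = 1"
  using assms unfolding valuations_def primitive_valuations_def PiE_iff by auto

lemma eval_onto: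
  assumes p: "(N, f) \<in> valuations n X" and x: "x \<in> X" "f x \<noteq> 0" and k: "k \<le> N"
  shows "\<exists>t\<in>dl_terms X. dl_eval (lukasiewicz_chain N) f t = k"
proof -
  define S where "S = dl_eval (lukasiewicz_chain N) f ` dl_terms X"
  have closed: "b - a \<in> S" if ab: "a \<in> S" "b \<in> S" for a b
  proof -
    obtain s t where "s \<in> dl_terms X" "t \<in> dl_terms X"
      "a = dl_eval (lukasiewicz_chain N) f s" "b = dl_eval (lukasiewicz_chain N) f t"
      using ab by (auto simp: S_def)
    then show ?thesis
      unfolding S_def by (intro image_eqI[of _ _ "Imp s t"]) simp_all
  qed
  have N: "N \<in> S"
    unfolding S_def using x by (intro image_eqI[of _ _ "Delta (Gen x)"]) simp_all
  have gens: "f y \<in> S" if "y \<in> X" for y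
    unfolding S_def using that by (intro image_eqI[of _ _ "Gen y"]) simp_all
  have "Gcd S dvd Gcd (insert N (f ` X))"
  proof (rule Gcd_greatest)
    fix k assume "k \<in> insert N (f ` X)"
    then have "k \<in> S"
      using N gens by blast
    then show "Gcd S dvd k"
      by (rule Gcd_dvd)
  qed
  then have "Gcd S = 1"
    by (simp only: valuationsD(4)[OF p] nat_dvd_1_iff_1)
  then have one: "1 \<in> S"
    using monus_closed_Gcd[OF closed N valuationsD(3)[OF p]] by metis
  have "N - j \<in> S" for j
  proof (induction j)
    case (Suc j)
    then show ?case
      using closed[OF one Suc] by simp
  qed (use N in simp)
  from this[of "N - k"] have "k \<in> S"
    using k by simp
  then show ?thesis
    unfolding S_def by blast
qed

text \<open>
  If every term that vanishes at \<open>(N, f)\<close> also vanished at \<open>(M, g)\<close>, then, comparing with a term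
  \<open>t\<close> of value \<open>1\<close> at \<open>(N, f)\<close>, all values at \<open>(M, g)\<close> would be those at \<open>(N, f)\<close> multiplied by
  the value of \<open>t\<close> at \<open>(M, g)\<close>.  As \<open>1\<close> is a value at \<open>(M, g)\<close>, this factor is \<open>1\<close> and the two
  valuations coincide.
\<close>
lemma eval_separates:
  assumes p: "(N, f) \<in> valuations n X" and q: "(M, g) \<in> valuations n X"
    and x: "x \<in> X" "f x \<noteq> 0" "g x \<noteq> 0" and pq: "(N, f) \<noteq> (M, g)"
  shows "\<exists>t\<in>dl_terms X. dl_eval (lukasiewicz_chain N) f t = 0 \<and> dl_eval (lukasiewicz_chain M) g t \<noteq> 0"
proof (rule ccontr)
  let ?p = "dl_eval (lukasiewicz_chain N) f" and ?q = "dl_eval (lukasiewicz_chain M) g"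
  assume "\<not> ?thesis"
  then have zero: "?q t = 0" if "t \<in> dl_terms X" "?p t = 0" for t
    using that by blast
  have "1 \<le> N" "1 \<le> M"
    using valuationsD(3)[OF p] valuationsD(3)[OF q] by simp_all
  obtain t where t: "t \<in> dl_terms X" "?p t = 1"
    using eval_onto[OF p x(1,2) \<open>1 \<le> N\<close>] by blast
  have it: "dl_eval (lukasiewicz_chain K) h (iter_imp Imp k t s) =
      dl_eval (lukasiewicz_chain K) h s - k * dl_eval (lukasiewicz_chain K) h t" for K h k s
    by (simp add: dl_eval_iter_imp iter_monus)
  have upper: "?q s \<le> ?p s * ?q t" if "s \<in> dl_terms X" for s
    using zero[of "iter_imp Imp (?p s) t s"] that t by (simp add: it)
  have scale: "?q s = ?p s * ?q t" if s: "s \<in> dl_terms X" for s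
  proof (cases "?p s")
    case 0
    then show ?thesis
      using zero[OF s] by simp
  next
    case (Suc k)
    have "?q t \<le> ?q s - k * ?q t"
      using zero[of "Imp (iter_imp Imp k t s) t"] s t Suc by (simp add: it)
    then have "?q t = 0 \<or> Suc k * ?q t \<le> ?q s"
      by auto
    then show ?thesis
      using upper[OF s] Suc by auto
  qed
  obtain s where "s \<in> dl_terms X" "?q s = 1"
    using eval_onto[OF q x(1,3) \<open>1 \<le> M\<close>] by blast
  then have one: "?q t = 1"
    using scale[of s] by simp
  have "N = M"
    using scale[of "Delta (Gen x)"] x one by simp
  moreover have "f = g"
  proof (rule extensionalityI)
    show "f y = g y" if "y \<in> X" for y
      using scale[of "Gen y"] that one by simp
  qed (rule valuationsD(2)[OF p], rule valuationsD(2)[OF q])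
  ultimately show False
    using pq by simp
qed

text \<open>
  Negation and strong conjunction of the MV-algebra on the elements above \<open>\<Delta>x\<close>; they have their
  usual meaning at the valuations that do not send \<open>x\<close> to the top.
\<close>
definition neg_above :: "'x \<Rightarrow> 'x dl_term \<Rightarrow> 'x dl_term" where
  "neg_above x t = Imp t (Delta (Gen x))"

definition conj_above :: "'x \<Rightarrow> 'x dl_term \<Rightarrow> 'x dl_term \<Rightarrow> 'x dl_term" where
  "conj_above x s t = neg_above x (Imp s (neg_above x t))"

lemma above_terms [simp]:
  assumes "x \<in> X"
  shows "neg_above x t \<in> dl_terms X \<longleftrightarrow> t \<in> dl_terms X"
    and "conj_above x s t \<in> dl_terms X \<longleftrightarrow> s \<in> dl_terms X \<and> t \<in> dl_terms X"
  using assms by (auto simp: neg_above_def conj_above_def)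

lemma eval_above [simp]:
  assumes "f x \<noteq> 0"
  shows "dl_eval (lukasiewicz_chain N) f (neg_above x t) = N - dl_eval (lukasiewicz_chain N) f t"
    and "dl_eval (lukasiewicz_chain N) f (conj_above x s t) =
      N - (N - dl_eval (lukasiewicz_chain N) f t - dl_eval (lukasiewicz_chain N) f s)"
  using assms by (simp_all add: neg_above_def conj_above_def)

lemma eval_characteristic:
  assumes "finite Q" "Q \<subseteq> {(M, g) \<in> valuations n X. g x \<noteq> 0}"
    and p: "(N, f) \<in> valuations n X" and x: "x \<in> X" "f x \<noteq> 0" and "(N, f) \<notin> Q"
  shows "\<exists>t\<in>dl_terms X. dl_eval (lukasiewicz_chain N) f t = 0 \<and>
    (\<forall>(M, g)\<in>Q. dl_eval (lukasiewicz_chain M) g t = M)"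
  using assms(1,2,6)
proof (induction Q)
  case empty
  show ?case
    by (intro bexI[of _ One]) auto
next
  case (insert q Q)
  obtain M g where q: "q = (M, g)"
    by (cases q)
  obtain t where t: "t \<in> dl_terms X" "dl_eval (lukasiewicz_chain N) f t = 0"
    "\<forall>(M, g)\<in>Q. dl_eval (lukasiewicz_chain M) g t = M"
    using insert by blast
  obtain s where s: "s \<in> dl_terms X" "dl_eval (lukasiewicz_chain N) f s = 0"
    "dl_eval (lukasiewicz_chain M) g s \<noteq> 0"
    using eval_separates[OF p, of M g x] x insert.prems q by auto
  show ?case
  proof (intro bexI[of _ "conj_above x t (Delta s)"] conjI)
    show "\<forall>(M, g)\<in>insert q Q. dl_eval (lukasiewicz_chain M) g (conj_above x t (Delta s)) = M"
      using insert.prems t s q by (fastforce simp del: dl_eval.simps(3) simp: dl_eval.simps(3))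
  qed (use t s x in simp_all)
qed

lemma eval_interpolation:
  assumes "finite Q" "Q \<subseteq> {(M, g) \<in> valuations n X. g x \<noteq> 0}" and x: "x \<in> X"
    and "\<forall>(M, g)\<in>Q. w (M, g) \<le> M"
  shows "\<exists>t\<in>dl_terms X. \<forall>(M, g)\<in>Q. dl_eval (lukasiewicz_chain M) g t = w (M, g)"
  using assms(1,2,4)
proof (induction Q)
  case empty
  show ?case
    by (intro bexI[of _ One]) auto
next
  case (insert q Q)
  obtain N f where q: "q = (N, f)"
    by (cases q)
  have f: "(N, f) \<in> valuations n X" "f x \<noteq> 0" "w (N, f) \<le> N"
    using insert.prems q by auto
  obtain t where t: "t \<in> dl_terms X" "\<forall>(M, g)\<in>Q. dl_eval (lukasiewicz_chain M) g t = w (M, g)"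
    using insert by blast
  obtain c where c: "c \<in> dl_terms X" "dl_eval (lukasiewicz_chain N) f c = 0"
    "\<forall>(M, g)\<in>Q. dl_eval (lukasiewicz_chain M) g c = M"
    using eval_characteristic[of Q n X x N f] f x insert q by auto
  obtain s where s: "s \<in> dl_terms X" "dl_eval (lukasiewicz_chain N) f s = w (N, f)"
    using eval_onto[OF f(1) x f(2,3)] by blast
  have le: "dl_eval (lukasiewicz_chain M) g u \<le> M"
    if "(M, g) \<in> insert q Q" "u \<in> dl_terms X" for M g u
    using eval_le[of g X M u] valuationsD(1)[of M g n X] insert.prems that by blast
  \<comment> \<open>The conditional: if \<open>c\<close> then \<open>s\<close> else \<open>t\<close>, where \<open>c\<close> is true at \<open>q\<close> and false on \<open>Q\<close>.\<close>
  let ?u = "conj_above x (Imp c s) (Imp (neg_above x c) t)"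
  have at_q: "dl_eval (lukasiewicz_chain N) f ?u = w (N, f)"
    using f c s le[of N f t] t q by simp
  have on_Q: "dl_eval (lukasiewicz_chain M) g ?u = w (M, g)" if "(M, g) \<in> Q" for M g
  proof -
    have "g x \<noteq> 0" "w (M, g) \<le> M" "dl_eval (lukasiewicz_chain M) g t = w (M, g)"
      "dl_eval (lukasiewicz_chain M) g c = M" "dl_eval (lukasiewicz_chain M) g s \<le> M"
      using insert.prems that t c s le by auto
    then show ?thesis
      by simp
  qed
  show ?case
    using at_q on_Q q t c s x by (intro bexI[of _ ?u]) auto
qed

text \<open>
  The interval above the join of the \<open>\<Delta>x\<close>, \<open>x \<in> S\<close>, in the product of the chains: this join takes
  the value \<open>0\<close> where some \<open>x \<in> S\<close> does, and the bottom value elsewhere.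
\<close>
definition principal_functions :: "nat \<Rightarrow> 'x set \<Rightarrow> 'x set \<Rightarrow> (nat \<times> ('x \<Rightarrow> nat) \<Rightarrow> nat) set" where
  "principal_functions n X S =
    (\<Pi>\<^sub>E (N, f) \<in> valuations n X. if \<exists>x\<in>S. f x = 0 then {0} else {0..N})"

lemma finite_primitive_valuations:
  assumes "finite X"
  shows "finite (primitive_valuations X N)"
proof (rule finite_subset)
  show "primitive_valuations X N \<subseteq> X \<rightarrow>\<^sub>E {0..N}"
    unfolding primitive_valuations_def by blast
qed (use assms in \<open>simp add: finite_PiE\<close>)

lemma finite_valuations: "finite X \<Longrightarrow> finite (valuations n X)"
  unfolding valuations_def by (simp add: finite_primitive_valuations)

lemma term_function_image:
  assumes "finite X" "X \<noteq> {}"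
  shows "term_function n X ` dl_terms X = (\<Union>x\<in>X. principal_functions n X {x})"
proof (intro set_eqI iffI)
  fix w assume "w \<in> term_function n X ` dl_terms X"
  then obtain t where t: "t \<in> dl_terms X" "w = term_function n X t"
    by auto
  obtain x where x: "x \<in> X" "\<And>N f. f x = 0 \<Longrightarrow> dl_eval (lukasiewicz_chain N) f t = 0"
    using eval_zero_of_variable[OF assms(2) t(1)] by blast
  have "dl_eval (lukasiewicz_chain N) f t \<in> (if \<exists>y\<in>{x}. f y = 0 then {0} else {0..N})"
    if "(N, f) \<in> valuations n X" for N f
    using x(2)[of f N] eval_le[OF valuationsD(1)[OF that] t(1)] by simp
  then have "w \<in> principal_functions n X {x}"
    unfolding principal_functions_def t(2) term_function_def restrict_PiE_iff
    by (simp add: split_beta)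
  then show "w \<in> (\<Union>x\<in>X. principal_functions n X {x})"
    using x(1) by blast
next
  fix w assume "w \<in> (\<Union>x\<in>X. principal_functions n X {x})"
  then obtain x where x: "x \<in> X" and w: "w \<in> principal_functions n X {x}"
    by blast
  have wp: "w (N, f) \<in> (if f x = 0 then {0} else {0..N})" if "(N, f) \<in> valuations n X" for N f
    using PiE_mem[OF w[unfolded principal_functions_def] that] by simp
  have w0: "w (N, f) = 0" if "(N, f) \<in> valuations n X" "f x = 0" for N f
    using wp[OF that(1)] that(2) by simp
  have wN: "w (N, f) \<le> N" if "(N, f) \<in> valuations n X" for N f
    using wp[OF that] by (simp split: if_splits)
  let ?Q = "{(M, g) \<in> valuations n X. g x \<noteq> 0}"
  have "finite ?Q"
    using finite_valuations[OF assms(1)] by (rule rev_finite_subset) auto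
  then obtain t where t: "t \<in> dl_terms X"
    "\<forall>(M, g)\<in>?Q. dl_eval (lukasiewicz_chain M) g t = w (M, g)"
    using eval_interpolation[of ?Q n X x w] x wN by auto
  \<comment> \<open>The double negation is the join of \<open>t\<close> with \<open>\<Delta>x\<close>: it keeps the values where \<open>x\<close> does not
    vanish and gives \<open>0\<close> where it does.\<close>
  let ?u = "neg_above x (neg_above x t)"
  have "dl_eval (lukasiewicz_chain N) f ?u = w (N, f)" if "(N, f) \<in> valuations n X" for N f
  proof (cases "f x = 0")
    case True
    then show ?thesis
      using w0[OF that] by (simp add: neg_above_def)
  next
    case False
    then have "dl_eval (lukasiewicz_chain N) f t = w (N, f)"
      using t(2) that by blast
    then show ?thesis
      using False wN[OF that] by simp
  qed
  note u = this
  have "w = term_function n X ?u"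
  proof (rule extensionalityI)
    show "w \<in> extensional (valuations n X)"
      using w unfolding principal_functions_def PiE_iff by blast
    show "term_function n X ?u \<in> extensional (valuations n X)"
      unfolding term_function_def by (rule restrict_extensional)
    show "w p = term_function n X ?u p" if "p \<in> valuations n X" for p
      using u that by (cases p) (simp add: term_function_def)
  qed
  then show "w \<in> term_function n X ` dl_terms X"
    using t x by auto
qed

section \<open>Counting\<close>

lemma image_eq_kernel_bij:
  assumes "\<And>s t. s \<in> T \<Longrightarrow> t \<in> T \<Longrightarrow> f s = f t \<longleftrightarrow> g s = g t"
  shows "bij_betw (g \<circ> inv_into T f) (f ` T) (g ` T)"
proof -
  have eq: "(g \<circ> inv_into T f) (f t) = g t" if "t \<in> T" for t
    using assms[of "inv_into T f (f t)" t] that by (simp add: inv_into_into f_inv_into_f)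
  show ?thesis
  proof (rule bij_betw_imageI)
    show "inj_on (g \<circ> inv_into T f) (f ` T)"
    proof (rule inj_onI)
      fix a b assume "a \<in> f ` T" "b \<in> f ` T" and ab: "(g \<circ> inv_into T f) a = (g \<circ> inv_into T f) b"
      then obtain s t where "s \<in> T" "t \<in> T" "a = f s" "b = f t"
        by blast
      then show "a = b"
        using ab eq assms by metis
    qed
    show "(g \<circ> inv_into T f) ` f ` T = g ` T"
      unfolding image_image using eq by (rule image_cong[OF HOL.refl])
  qed
qed

text \<open>
  The right-hand side counts all valuations in the chain of \<open>N + 1\<close> elements without zeros on \<open>S\<close>.
  Each of them is uniquely \<open>N div e\<close> times a primitive valuation in the chain of \<open>e + 1\<close> elements,
  the factor being the greatest common divisor of \<open>N\<close> and the values.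
\<close>
lemma primitive_count:
  assumes X: "finite X" "S \<subseteq> X" "S \<noteq> {}" and N: "N > 0"
  shows "(\<Sum>e | e dvd N. card {f \<in> primitive_valuations X e. \<forall>x\<in>S. f x \<noteq> 0}) =
    N ^ card S * (N + 1) ^ (card X - card S)"
proof -
  let ?P = "\<lambda>e. {f \<in> primitive_valuations X e. \<forall>x\<in>S. f x \<noteq> 0}"
  let ?W = "\<Pi>\<^sub>E x\<in>X. if x \<in> S then {1..N} else {0..N}"
  let ?h = "\<lambda>(e, f). \<lambda>x\<in>X. (N div e) * f x"
  have fin: "finite (primitive_valuations X e)" for e
    using X(1) by (rule finite_primitive_valuations)
  have Gcd_h: "Gcd (insert N (?h (e, f) ` X)) = N div e" if "e dvd N" "f \<in> primitive_valuations X e" for e f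
  proof -
    have "insert N (?h (e, f) ` X) = (*) (N div e) ` insert e (f ` X)"
      using that(1) by (auto simp: image_iff)
    then show ?thesis
      using that(2) by (simp only: Gcd_mult) (simp add: primitive_valuations_def)
  qed
  have "bij_betw ?h (SIGMA e:{e. e dvd N}. ?P e) ?W"
  proof (rule bij_betw_imageI)
    show "inj_on ?h (SIGMA e:{e. e dvd N}. ?P e)"
    proof (rule inj_onI)
      fix p q
      assume pq: "p \<in> (SIGMA e:{e. e dvd N}. ?P e)" "q \<in> (SIGMA e:{e. e dvd N}. ?P e)"
        and h: "?h p = ?h q"
      obtain e f e' f' where p: "p = (e, f)" and q: "q = (e', f')"
        by (cases p, cases q)
      have e: "e dvd N" "f \<in> primitive_valuations X e"
        and e': "e' dvd N" "f' \<in> primitive_valuations X e'"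
        using pq p q by auto
      have eq: "?h (e, f) = ?h (e', f')"
        using h unfolding p q .
      have "N div e = Gcd (insert N (?h (e, f) ` X))"
        by (rule Gcd_h[OF e, symmetric])
      also have "\<dots> = N div e'"
        unfolding eq by (rule Gcd_h[OF e'])
      finally have quot: "N div e = N div e'" .
      then have "e = e'"
        using e(1) e'(1) N
        by (metis dvd_div_eq_mult dvd_mult_div_cancel nat_mult_eq_cancel_disj mult.commute
            not_gr0 div_eq_0_iff dvd_imp_le leD)
      moreover have "f = f'"
      proof (rule extensionalityI)
        fix x assume "x \<in> X"
        then have "(N div e) * f x = (N div e) * f' x"
          using fun_cong[OF eq, of x] quot by simp
        moreover have "N div e > 0"
          using e(1) N by (simp add: dvd_imp_le div_greater_zero_iff dvd_pos_nat)
        ultimately show "f x = f' x"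
          by simp
      qed (use e e' in \<open>auto simp: primitive_valuations_def PiE_iff\<close>)
      ultimately show "p = q"
        using p q by simp
    qed
    show "?h ` (SIGMA e:{e. e dvd N}. ?P e) = ?W"
    proof (intro set_eqI iffI)
      fix w assume "w \<in> ?h ` (SIGMA e:{e. e dvd N}. ?P e)"
      then obtain e f where ef: "e dvd N" "f \<in> ?P e" "w = ?h (e, f)"
        by auto
      have "(N div e) * f x \<le> N" if "x \<in> X" for x
      proof -
        have "(N div e) * f x \<le> (N div e) * e"
          using ef(2) that by (intro mult_le_mono2) (auto simp: primitive_valuations_def PiE_iff)
        then show ?thesis
          using ef(1) by simp
      qed
      moreover have "N div e > 0"
        using ef(1) N by (simp add: dvd_imp_le div_greater_zero_iff dvd_pos_nat)
      ultimately show "w \<in> ?W"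
        using ef X(2) by (auto simp: PiE_iff Suc_le_eq)
    next
      fix w assume w: "w \<in> ?W"
      have "w \<in> X \<rightarrow> {0..N}"
        using w by (auto simp: PiE_iff split: if_splits)
      then obtain d e g where deg: "N = d * e" "g \<in> primitive_valuations X e" "\<And>x. x \<in> X \<Longrightarrow> w x = d * g x"
        using primitive_reduction[OF N] by metis
      have pos: "\<forall>x\<in>S. g x \<noteq> 0"
      proof
        fix x assume "x \<in> S"
        then have "x \<in> X"
          using X(2) by blast
        then have "w x \<in> {1..N}"
          using PiE_mem[OF w] \<open>x \<in> S\<close> by fastforce
        then show "g x \<noteq> 0"
          using deg(3)[OF \<open>x \<in> X\<close>] by auto
      qed
      have "e > 0"
        using N deg(1) by (auto intro: Nat.gr0I)
      then have "w = ?h (e, g)"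
        using w deg by (intro extensionalityI[of _ X]) (auto simp: PiE_iff)
      then show "w \<in> ?h ` (SIGMA e:{e. e dvd N}. ?P e)"
        using deg pos by (intro image_eqI[of _ _ "(e, g)"]) auto
    qed
  qed
  then have "card (SIGMA e:{e. e dvd N}. ?P e) = card ?W"
    by (rule bij_betw_same_card)
  also have "card (SIGMA e:{e. e dvd N}. ?P e) = (\<Sum>e | e dvd N. card (?P e))"
    using N fin by (intro card_SigmaI) auto
  also have "card ?W = (\<Prod>x\<in>X. if x \<in> S then N else N + 1)"
    using X(1) by (simp add: card_PiE if_distrib[of card] cong: if_cong)
  also have "\<dots> = N ^ card S * (N + 1) ^ card (X - S)"
    using X by (simp add: prod.If_cases Int_absorb1 Diff_eq[symmetric])
  finally show ?thesis
    using X by (simp add: card_Diff_subset finite_subset)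
qed

text \<open>Isolating the summand \<open>e = N\<close> in \<open>primitive_count\<close> yields the recursion that defines \<open>\<beta>\<close>.\<close>
lemma dl_beta_eq_card:
  assumes X: "finite X" "S \<subseteq> X" "S \<noteq> {}" and "N > 0"
  shows "dl_beta (card X) (card S) (Suc N) = int (card {f \<in> primitive_valuations X N. \<forall>x\<in>S. f x \<noteq> 0})"
  using assms(4)
proof (induction N rule: less_induct)
  case (less N)
  let ?b = "\<lambda>e. card {f \<in> primitive_valuations X e. \<forall>x\<in>S. f x \<noteq> 0}"
  have "(\<Sum>j | 2 \<le> j \<and> j < Suc N \<and> (j - 1) dvd (Suc N - 1). dl_beta (card X) (card S) j) =
      (\<Sum>e | e dvd N \<and> e < N. int (?b e))"
  proof (rule sum.reindex_bij_witness[of _ Suc "\<lambda>j. j - 1"])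
    fix j assume j: "j \<in> {j. 2 \<le> j \<and> j < Suc N \<and> (j - 1) dvd (Suc N - 1)}"
    then have "j - 1 < N" "0 < j - 1" "Suc (j - 1) = j"
      by auto
    then show "int (?b (j - 1)) = dl_beta (card X) (card S) j"
      using less.IH[of "j - 1"] by simp
  next
    fix e assume "e \<in> {e. e dvd N \<and> e < N}"
    then show "Suc e \<in> {j. 2 \<le> j \<and> j < Suc N \<and> (j - 1) dvd (Suc N - 1)}"
      using less.prems by (cases e) auto
  qed auto
  moreover have "{e. e dvd N} = insert N {e. e dvd N \<and> e < N}"
    using less.prems by (auto dest: dvd_imp_le simp: le_less)
  then have "(\<Sum>e | e dvd N. int (?b e)) = int (?b N) + (\<Sum>e | e dvd N \<and> e < N. int (?b e))"
    by simp
  moreover have "(\<Sum>e | e dvd N. int (?b e)) = int N ^ card S * (int N + 1) ^ (card X - card S)"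
    using primitive_count[OF X less.prems] by (simp add: add.commute flip: of_nat_sum)
  ultimately show ?case
    by (subst dl_beta.simps) (simp add: add.commute)
qed

lemma card_principal_functions:
  assumes X: "finite X" "S \<subseteq> X" "S \<noteq> {}"
  shows "finite (principal_functions n X S)"
    and "real (card (principal_functions n X S)) =
      (\<Prod>i = 2..n. real i powi dl_beta (card X) (card S) i)"
proof -
  have fin: "finite (primitive_valuations X N)" for N
    using X(1) by (rule finite_primitive_valuations)
  show "finite (principal_functions n X S)"
    unfolding principal_functions_def using finite_valuations[OF X(1)] by (intro finite_PiE) auto
  have "card (principal_functions n X S) =
      (\<Prod>(N, f)\<in>valuations n X. if \<exists>x\<in>S. f x = 0 then 1 else N + 1)"
    unfolding principal_functions_def
    by (subst card_PiE[OF finite_valuations[OF X(1)]])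
      (simp add: split_beta if_distrib[of card] cong: if_cong)
  also have "\<dots> = (\<Prod>N = 1..n - 1. \<Prod>f\<in>primitive_valuations X N. if \<exists>x\<in>S. f x = 0 then 1 else N + 1)"
    unfolding valuations_def using fin by (subst prod.Sigma) auto
  also have "\<dots> = (\<Prod>N = 1..n - 1. (N + 1) ^ card {f \<in> primitive_valuations X N. \<forall>x\<in>S. f x \<noteq> 0})"
  proof (rule prod.cong[OF HOL.refl])
    fix N
    have "primitive_valuations X N \<inter> - {f. \<exists>x\<in>S. f x = 0} =
        {f \<in> primitive_valuations X N. \<forall>x\<in>S. f x \<noteq> 0}"
      by auto
    then show "(\<Prod>f\<in>primitive_valuations X N. if \<exists>x\<in>S. f x = 0 then 1 else N + 1) =
        (N + 1) ^ card {f \<in> primitive_valuations X N. \<forall>x\<in>S. f x \<noteq> 0}"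
      using fin by (simp add: prod.If_cases)
  qed
  finally have "real (card (principal_functions n X S)) =
      (\<Prod>N = 1..n - 1. real (N + 1) ^ card {f \<in> primitive_valuations X N. \<forall>x\<in>S. f x \<noteq> 0})"
    by simp
  also have "\<dots> = (\<Prod>N = 1..n - 1. real (N + 1) powi dl_beta (card X) (card S) (N + 1))"
    using dl_beta_eq_card[OF X] by (intro prod.cong) simp_all
  also have "\<dots> = (\<Prod>i = 2..n. real i powi dl_beta (card X) (card S) i)"
    by (rule prod.reindex_bij_witness[of _ "\<lambda>i. i - 1" Suc]) auto
  finally show "real (card (principal_functions n X S)) =
      (\<Prod>i = 2..n. real i powi dl_beta (card X) (card S) i)" .
qed

lemma Inter_principal_functions:
  assumes "S \<noteq> {}"
  shows "(\<Inter>x\<in>S. principal_functions n X {x}) = principal_functions n X S"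
proof (intro set_eqI iffI)
  fix w assume w: "w \<in> (\<Inter>x\<in>S. principal_functions n X {x})"
  obtain y where y: "y \<in> S"
    using assms by blast
  show "w \<in> principal_functions n X S"
    unfolding principal_functions_def
  proof (rule PiE_I)
    fix p assume p: "p \<in> valuations n X"
    obtain N f where Nf: "p = (N, f)" by (cases p)
    have "w p \<in> (if f x = 0 then {0} else {0..N})" if "x \<in> S" for x
      using w that p Nf by (fastforce simp: principal_functions_def PiE_iff)
    note wp = this
    have "w p \<in> (if \<exists>x\<in>S. f x = 0 then {0} else {0..N})"
    proof (cases "\<exists>x\<in>S. f x = 0")
      case True
      then obtain x where "x \<in> S" "f x = 0"
        by blast
      then show ?thesis
        using wp[of x] True by simp
    next
      case False
      then show ?thesis
        using wp[OF y] y by (metis (full_types))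
    qed
    then show "w p \<in> (case p of (N, f) \<Rightarrow> if \<exists>x\<in>S. f x = 0 then {0} else {0..N})"
      using Nf by simp
  next
    fix p assume p: "p \<notin> valuations n X"
    have "w \<in> principal_functions n X {y}"
      using w y by blast
    then show "w p = undefined"
      unfolding principal_functions_def using p by (rule PiE_arb)
  qed
next
  fix w assume w: "w \<in> principal_functions n X S"
  show "w \<in> (\<Inter>x\<in>S. principal_functions n X {x})"
    using w by (fastforce simp: principal_functions_def PiE_iff split: if_splits)
qed

theorem mainTheorem1:
  fixes n m :: nat and X :: "'x set"
  assumes "n \<ge> 2" and "m \<ge> 1" and "finite X" and "card X = m"
  shows "finite (dl_carrier (free_dl_algebra n X)) \<and>
    real (card (dl_carrier (free_dl_algebra n X))) =
      (\<Sum>k = 1..m. (-1) ^ (k + 1) * real (m choose k) *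
        (\<Prod>i = 2..n. real i powi dl_beta m k i))"
proof -
  let ?b = "\<lambda>k. \<Prod>i = 2..n. real i powi dl_beta m k i"
  let ?U = "\<Union>x\<in>X. principal_functions n X {x}"
  have X: "X \<noteq> {}"
    using assms by auto
  have "bij_betw (term_function n X \<circ> inv_into (dl_terms X) (dl_class n X))
      (dl_class n X ` dl_terms X) (term_function n X ` dl_terms X)"
    using assms(1) by (intro image_eq_kernel_bij) (simp add: dl_class_eq_iff dl_eq_iff_term_function)
  then have bij: "bij_betw (term_function n X \<circ> inv_into (dl_terms X) (dl_class n X))
      (dl_carrier (free_dl_algebra n X)) ?U"
    by (simp only: free_carrier term_function_image[OF assms(3) X])
  have fin: "finite (principal_functions n X {x})" if "x \<in> X" for x
    using card_principal_functions(1)[of X "{x}"] that assms(3) by simp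
  interpret Incl_Excl finite "\<lambda>A. real (card A)"
    by unfold_locales (auto simp: card_Un_disjnt)
  have "real (card ?U) = (\<Sum>S | S \<subseteq> X \<and> S \<noteq> {}.
      (-1) ^ (card S + 1) * real (card (\<Inter>x\<in>S. principal_functions n X {x})))"
    using assms(3) fin by (rule restricted_indexed)
  also have "\<dots> = (\<Sum>S | S \<subseteq> X \<and> S \<noteq> {}. (-1) ^ (card S + 1) * ?b (card S))"
    using card_principal_functions(2)[OF assms(3)] assms(4)
    by (intro sum.cong) (auto simp: Inter_principal_functions)
  also have "\<dots> = (\<Sum>k = 1..m. \<Sum>S | S \<in> {S. S \<subseteq> X \<and> S \<noteq> {}} \<and> card S = k.
      (-1) ^ (card S + 1) * ?b (card S))"
  proof (rule sum.group[symmetric])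
    show "card ` {S. S \<subseteq> X \<and> S \<noteq> {}} \<subseteq> {1..m}"
      using assms(3,4) by (auto simp: Suc_le_eq card_gt_0_iff finite_subset intro: card_mono)
  qed (use assms(3) in auto)
  also have "\<dots> = (\<Sum>k = 1..m. (-1) ^ (k + 1) * real (m choose k) * ?b k)"
  proof (rule sum.cong[OF HOL.refl])
    fix k assume k: "k \<in> {1..m}"
    have "{S. S \<in> {S. S \<subseteq> X \<and> S \<noteq> {}} \<and> card S = k} = {S. S \<subseteq> X \<and> card S = k}"
      using k by auto
    then show "(\<Sum>S | S \<in> {S. S \<subseteq> X \<and> S \<noteq> {}} \<and> card S = k. (-1) ^ (card S + 1) * ?b (card S)) =
        (-1) ^ (k + 1) * real (m choose k) * ?b k"
      using n_subsets[OF assms(3), of k] assms(4) by simp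
  qed
  finally show ?thesis
    using bij fin assms(3) bij_betw_finite[OF bij] bij_betw_same_card[OF bij] by simp
qed

end
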